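(* Let $(X,d)$ be a Polish metric space and $G$ a closed subgroup of $\mathrm{Iso}(X,d)$ whose action on $(X,d)$ is approximately oligomorphic. Let $\tau$ be the topology of pointwise convergence on $G$ and $\partial(g,h)=\sup_{x\in X}d(gx,hx)$ the metric of uniform convergence, and assume that $(G,\tau,\partial)$ has ample generics. Then $(G,\partial)$ is metrically $21$-Bergman.
   Context: The action of $G$ by isometries on $(X,d)$ is approximately oligomorphic if for every $n\in\mathbb N$ and $\varepsilon>0$ there exist $\bar b_1,\dots,\bar b_k\in X^n$ such that for every $\bar x\in X^n$ there are $j\in\{1,\dots,k\}$ and $g\in G$ with $d(g\cdot\bar b_j,\bar x)\le\varepsilon$ ($X^n$ with the supremum metric). For $A$ in a metric space, $(A)_\varepsilon=\{y\colon\partial(y,A)<\varepsilon\}$. $(G,\tau,\partial)$ has ample generics if for all $n\in\mathbb N$ and $\varepsilon>0$ there is $\bar g\in G^n$ such that $(\{(kg_0k^{-1},\dots,kg_{n-1}k^{-1})\colon k\in G\})_\varepsilon$ is co-meagre in $(G^n,\tau)$, where $G^n$ has the supremum metric. $(G,\partial)$ is metrically $k$-Bergman if whenever $W_0\subseteq W_1\subseteq\cdots$ is an increasing sequence of subsets of $G$ with $\bigcup_nW_n=G$, for every $\varepsilon>0$ there is $n$ with $\big((W_n)_\varepsilon\big)^k=G$. *)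

theory Defs
  imports "HOL-Analysis.Analysis"
begin

definition isometry :: "('a::metric_space \<Rightarrow> 'a) \<Rightarrow> bool" where
  "isometry g \<longleftrightarrow> (\<forall>x y. dist (g x) (g y) = dist x y) \<and> surj g"

definition Iso :: "('a::metric_space \<Rightarrow> 'a) set" where
  "Iso = {g. isometry g}"

definition pointwise_top :: "('a::topological_space \<Rightarrow> 'a) topology" where
  "pointwise_top = product_topology (\<lambda>_. euclidean) UNIV"

definition is_subgroup_Iso :: "('a::metric_space \<Rightarrow> 'a) set \<Rightarrow> bool" where
  "is_subgroup_Iso G \<longleftrightarrow> G \<subseteq> Iso \<and> id \<in> G \<and>
     (\<forall>g\<in>G. \<forall>h\<in>G. g \<circ> h \<in> G) \<and> (\<forall>g\<in>G. inv g \<in> G)"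

definition closed_subgroup_Iso :: "('a::metric_space \<Rightarrow> 'a) set \<Rightarrow> bool" where
  "closed_subgroup_Iso G \<longleftrightarrow> is_subgroup_Iso G \<and>
     closedin (subtopology pointwise_top Iso) G"

(* uniform metric (possibly infinite, hence ereal) *)
definition unif_dist :: "('a::metric_space \<Rightarrow> 'a) \<Rightarrow> ('a \<Rightarrow> 'a) \<Rightarrow> ereal" where
  "unif_dist g h = (SUP x. ereal (dist (g x) (h x)))"

definition approx_oligomorphic :: "('a::metric_space \<Rightarrow> 'a) set \<Rightarrow> bool" where
  "approx_oligomorphic G \<longleftrightarrow>
     (\<forall>(n::nat) (\<epsilon>::real). \<epsilon> > 0 \<longrightarrow>
        (\<exists>B :: (nat \<Rightarrow> 'a) set. finite B \<and>
          (\<forall>x :: nat \<Rightarrow> 'a. \<exists>b\<in>B. \<exists>g\<in>G. \<forall>i<n. dist (g (b i)) (x i) \<le> \<epsilon>)))"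

definition nowhere_dense_in :: "'a topology \<Rightarrow> 'a set \<Rightarrow> bool" where
  "nowhere_dense_in T A \<longleftrightarrow> T interior_of (T closure_of A) = {}"

definition meagre_in :: "'a topology \<Rightarrow> 'a set \<Rightarrow> bool" where
  "meagre_in T A \<longleftrightarrow> (\<exists>F. countable F \<and> (\<forall>N\<in>F. nowhere_dense_in T N) \<and> A \<subseteq> \<Union>F)"

definition comeagre_in :: "'a topology \<Rightarrow> 'a set \<Rightarrow> bool" where
  "comeagre_in T A \<longleftrightarrow> A \<subseteq> topspace T \<and> meagre_in T (topspace T - A)"

definition tau :: "('a::metric_space \<Rightarrow> 'a) set \<Rightarrow> ('a \<Rightarrow> 'a) topology" where
  "tau G = subtopology pointwise_top G"

definition tau_pow :: "('a::metric_space \<Rightarrow> 'a) set \<Rightarrow> nat \<Rightarrow> (nat \<Rightarrow> ('a \<Rightarrow> 'a)) topology" where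
  "tau_pow G n = product_topology (\<lambda>_. tau G) {..<n}"

definition conj_orbit :: "('a::metric_space \<Rightarrow> 'a) set \<Rightarrow> nat \<Rightarrow> (nat \<Rightarrow> ('a \<Rightarrow> 'a)) \<Rightarrow> (nat \<Rightarrow> ('a \<Rightarrow> 'a)) set" where
  "conj_orbit G n g = {(\<lambda>i\<in>{..<n}. k \<circ> g i \<circ> inv k) | k. k \<in> G}"

definition nbhd_pow :: "('a::metric_space \<Rightarrow> 'a) set \<Rightarrow> nat \<Rightarrow> (nat \<Rightarrow> ('a \<Rightarrow> 'a)) set \<Rightarrow> real \<Rightarrow> (nat \<Rightarrow> ('a \<Rightarrow> 'a)) set" where
  "nbhd_pow G n A \<epsilon> = {y \<in> PiE {..<n} (\<lambda>_. G). \<exists>a\<in>A. \<forall>i<n. unif_dist (y i) (a i) < ereal \<epsilon>}"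

definition ample_generics :: "('a::metric_space \<Rightarrow> 'a) set \<Rightarrow> bool" where
  "ample_generics G \<longleftrightarrow>
     (\<forall>(n::nat) (\<epsilon>::real). \<epsilon> > 0 \<longrightarrow>
        (\<exists>g \<in> PiE {..<n} (\<lambda>_. G). comeagre_in (tau_pow G n) (nbhd_pow G n (conj_orbit G n g) \<epsilon>)))"

definition nbhd :: "('a::metric_space \<Rightarrow> 'a) set \<Rightarrow> ('a \<Rightarrow> 'a) set \<Rightarrow> real \<Rightarrow> ('a \<Rightarrow> 'a) set" where
  "nbhd G W \<epsilon> = {y \<in> G. \<exists>w\<in>W. unif_dist y w < ereal \<epsilon>}"

fun set_power :: "('a \<Rightarrow> 'a) set \<Rightarrow> nat \<Rightarrow> ('a \<Rightarrow> 'a) set" where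
  "set_power S 0 = {id}"
| "set_power S (Suc k) = {s \<circ> t | s t. s \<in> S \<and> t \<in> set_power S k}"

definition metrically_Bergman :: "nat \<Rightarrow> ('a::metric_space \<Rightarrow> 'a) set \<Rightarrow> bool" where
  "metrically_Bergman k G \<longleftrightarrow>
     (\<forall>W :: nat \<Rightarrow> ('a \<Rightarrow> 'a) set.
        (\<forall>n. W n \<subseteq> W (Suc n)) \<and> (\<Union>n. W n) = G \<longrightarrow>
        (\<forall>\<epsilon>::real. \<epsilon> > 0 \<longrightarrow> (\<exists>n. set_power (nbhd G (W n) \<epsilon>) k = G)))"

end

(* A version up to epsilon of the argument of Kechris and Rosendal. Passing to the sets of all g with
   g and its inverse in W n, one may assume that the W n are symmetric, and after dropping finitely
   many of them that they are non-meagre. Suppose that no fifth power of a neighbourhood (W n)_eps is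
   comeagre in a non-empty open set. Then one builds group elements h as limits of a branching process:
   at stage n, ample generics provide generic extensions of the current tuple by g0 in W n and by g1
   outside the fifth power, together with a small v that almost fixes the tuple and almost
   conjugates g0 to g1; one branch keeps h, the other one replaces h by h v^-1. Not both branches can
   have limits in W n, so some limit avoids all the W n, which is absurd. Hence some fifth power is
   comeagre in a non-empty open set, its tenth power contains an identity neighbourhood V, and
   approximate oligomorphicity gives G = V F V with F finite, whence 21 = 10 + 1 + 10. *)

theory Submission
  imports Defs
begin

section \<open>Baire category\<close>

text \<open>What shapes the argument is the demand that \<open>v\<close> be small: generic tuples of
  equal length are approximately conjugate, but by conjugators anywhere in the group. Countably many
  classes cover these conjugators, so the set of elements reached from g0 by small ones is
  non-meagre; as the projection of a closed set it is then comeagre in some non-empty open set. The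
  position of that open set cannot be prescribed. Hence g1 is found in it only because the
  complement of the fifth power is, by the assumption to be refuted, non-meagre in every non-empty
  open set, whereas for g0 non-meagreness of W n suffices. Five is the number of factors in g1 = inv
  b * a * m * inv a * b, where a and b are limits of the two branches lying in W n and m = inv a * b
  * g1 * inv b * a. Conjugating g0 by a and g1 by b gives the same result up to a small uniform
  error, so m is uniformly close to g0. No tree of limits is needed: each stage keeps a child whose
  set of all possible limits misses W n, and this single path contradicts the covering of G.\<close>

lemma nowhere_dense_in_subset:
  "nowhere_dense_in T B \<Longrightarrow> A \<subseteq> B \<Longrightarrow> nowhere_dense_in T A"
  unfolding nowhere_dense_in_def by (metis closure_of_mono interior_of_mono subset_empty)

lemma meagre_in_subset: "meagre_in T B \<Longrightarrow> A \<subseteq> B \<Longrightarrow> meagre_in T A"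
  unfolding meagre_in_def by (meson subset_trans)

lemma meagre_in_empty [simp]: "meagre_in T {}"
  unfolding meagre_in_def by (rule exI[of _ "{}"]) auto

lemma nowhere_dense_imp_meagre_in: "nowhere_dense_in T A \<Longrightarrow> meagre_in T A"
  unfolding meagre_in_def by (rule exI[of _ "{A}"]) auto

lemma meagre_in_countable_Union:
  assumes "countable I" and "\<And>i. i \<in> I \<Longrightarrow> meagre_in T (A i)"
  shows "meagre_in T (\<Union>i\<in>I. A i)"
proof -
  obtain F where F: "\<And>i. i \<in> I \<Longrightarrow> countable (F i) \<and> (\<forall>N\<in>F i. nowhere_dense_in T N) \<and> A i \<subseteq> \<Union>(F i)"
    using assms(2) unfolding meagre_in_def by metis
  show ?thesis
    unfolding meagre_in_def
  proof (intro exI conjI)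
    show "countable (\<Union>i\<in>I. F i)" using F assms(1) by blast
    show "\<forall>N\<in>\<Union>i\<in>I. F i. nowhere_dense_in T N" using F by blast
    have "A i \<subseteq> \<Union>(\<Union>i\<in>I. F i)" if "i \<in> I" for i
    proof -
      have "A i \<subseteq> \<Union>(F i)" using F that by simp
      also have "\<dots> \<subseteq> \<Union>(\<Union>i\<in>I. F i)" using that by (intro Union_mono UN_upper)
      finally show ?thesis .
    qed
    then show "(\<Union>i\<in>I. A i) \<subseteq> \<Union>(\<Union>i\<in>I. F i)" by (rule UN_least)
  qed
qed

lemma meagre_in_Un: "meagre_in T A \<Longrightarrow> meagre_in T B \<Longrightarrow> meagre_in T (A \<union> B)"
  using meagre_in_countable_Union[of "{True, False}" T "\<lambda>b. if b then A else B"]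
  by (auto simp: Un_commute)

lemma comeagre_in_mono:
  "comeagre_in T A \<Longrightarrow> A \<subseteq> B \<Longrightarrow> B \<subseteq> topspace T \<Longrightarrow> comeagre_in T B"
  unfolding comeagre_in_def by (meson Diff_mono meagre_in_subset order_refl)

lemma comeagre_in_countable_INT:
  assumes "countable I" "\<And>i. i \<in> I \<Longrightarrow> comeagre_in T (A i)"
  shows "comeagre_in T (topspace T \<inter> (\<Inter>i\<in>I. A i))"
proof -
  have "topspace T - topspace T \<inter> (\<Inter>i\<in>I. A i) = (\<Union>i\<in>I. topspace T - A i)" by auto
  then show ?thesis
    using meagre_in_countable_Union[OF assms(1), of T "\<lambda>i. topspace T - A i"] assms(2)
    unfolding comeagre_in_def by auto
qed

lemma comeagre_in_Int:
  assumes "comeagre_in T A" "comeagre_in T B"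
  shows "comeagre_in T (A \<inter> B)"
proof -
  have "topspace T - A \<inter> B = (topspace T - A) \<union> (topspace T - B)" by auto
  then show ?thesis using assms unfolding comeagre_in_def by (auto intro: meagre_in_Un)
qed

lemma nonmeagre_in_Int_comeagre_in:
  assumes "\<not> meagre_in T A" "A \<subseteq> topspace T" "comeagre_in T B"
  shows "\<not> meagre_in T (A \<inter> B)"
proof
  assume "meagre_in T (A \<inter> B)"
  moreover have "meagre_in T (topspace T - B)" using assms(3) by (simp add: comeagre_in_def)
  ultimately have "meagre_in T (A \<inter> B \<union> (topspace T - B))" by (rule meagre_in_Un)
  then show False using assms(1,2) by (meson Diff_iff IntI UnI1 UnI2 meagre_in_subset subsetD subsetI)
qed

lemma nowhere_dense_in_homeomorphic_image:
  assumes "homeomorphic_map X Y f" "nowhere_dense_in X A" "A \<subseteq> topspace X"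
  shows "nowhere_dense_in Y (f ` A)"
  using assms unfolding nowhere_dense_in_def
  by (metis closure_of_subset_topspace homeomorphic_map_closure_of homeomorphic_map_interior_of image_empty)

lemma meagre_in_homeomorphic_image:
  assumes "homeomorphic_map X Y f" "meagre_in X A" "A \<subseteq> topspace X"
  shows "meagre_in Y (f ` A)"
proof -
  obtain F where F: "countable F" "\<And>N. N \<in> F \<Longrightarrow> nowhere_dense_in X N" "A \<subseteq> \<Union>F"
    using assms(2) unfolding meagre_in_def by blast
  have "nowhere_dense_in Y (f ` (N \<inter> topspace X))" if "N \<in> F" for N
    using F(2)[OF that] assms(1)
    by (meson Int_lower1 Int_lower2 nowhere_dense_in_homeomorphic_image nowhere_dense_in_subset)
  moreover have "f ` A \<subseteq> \<Union> ((\<lambda>N. f ` (N \<inter> topspace X)) ` F)" using F(3) assms(3) by blast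
  ultimately show ?thesis
    unfolding meagre_in_def using F(1) by (intro exI[of _ "(\<lambda>N. f ` (N \<inter> topspace X)) ` F"]) auto
qed

lemma nowhere_dense_in_complement_open_dense:
  assumes "openin T U" "T closure_of U = topspace T"
  shows "nowhere_dense_in T (topspace T - U)"
proof -
  have "closedin T (topspace T - U)" using assms(1) by blast
  then show ?thesis
    unfolding nowhere_dense_in_def
    by (simp add: closure_of_closedin interior_of_complement assms(2))
qed

lemma comeagre_in_open_dense:
  "openin T U \<Longrightarrow> T closure_of U = topspace T \<Longrightarrow> comeagre_in T U"
  unfolding comeagre_in_def
  using nowhere_dense_imp_meagre_in nowhere_dense_in_complement_open_dense openin_subset by blast

lemma comeagre_in_obtain_open_dense:
  assumes "comeagre_in T A"
  obtains \<U> where "countable \<U>" "\<And>U. U \<in> \<U> \<Longrightarrow> openin T U \<and> T closure_of U = topspace T"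
    "topspace T \<inter> \<Inter>\<U> \<subseteq> A"
proof -
  obtain F where F: "countable F" "\<And>N. N \<in> F \<Longrightarrow> nowhere_dense_in T N" "topspace T - A \<subseteq> \<Union>F"
    using assms unfolding comeagre_in_def meagre_in_def by blast
  let ?U = "(\<lambda>N. topspace T - T closure_of N) ` F"
  show thesis
  proof
    show "countable ?U" using F(1) by simp
    show "openin T U \<and> T closure_of U = topspace T" if "U \<in> ?U" for U
    proof -
      obtain N where N: "N \<in> F" "U = topspace T - T closure_of N" using \<open>U \<in> ?U\<close> by blast
      then show ?thesis
        using F(2)[OF N(1)] closure_of_complement[of T "T closure_of N"]
        by (simp add: nowhere_dense_in_def openin_diff)
    qed
    show "topspace T \<inter> \<Inter>?U \<subseteq> A"
    proof
      fix x assume x: "x \<in> topspace T \<inter> \<Inter>?U"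
      show "x \<in> A"
      proof (rule ccontr)
        assume "x \<notin> A"
        then obtain N where "N \<in> F" "x \<in> N" using x F(3) by blast
        then have "x \<in> T closure_of N" using x by (meson IntD1 closure_of_subset_Int IntI subsetD)
        then show False using x \<open>N \<in> F\<close> by blast
      qed
    qed
  qed
qed

lemma completely_metrizable_nonmeagre_open:
  assumes "completely_metrizable_space T" "openin T U" "U \<noteq> {}"
  shows "\<not> meagre_in T U"
proof
  assume "meagre_in T U"
  then obtain F where F: "countable F" "\<And>N. N \<in> F \<Longrightarrow> nowhere_dense_in T N" "U \<subseteq> \<Union>F"
    unfolding meagre_in_def by blast
  have "T interior_of \<Union>((\<lambda>N. T closure_of N) ` F) = {}"
    using F by (intro Baire_category_alt) (use assms(1) in \<open>auto simp: nowhere_dense_in_def\<close>)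
  moreover have "U \<subseteq> \<Union>((\<lambda>N. T closure_of N) ` F)"
  proof
    fix x assume "x \<in> U"
    then obtain N where "N \<in> F" "x \<in> N" using F(3) by blast
    moreover have "x \<in> topspace T" using \<open>x \<in> U\<close> assms(2) openin_subset by blast
    ultimately show "x \<in> \<Union>((\<lambda>N. T closure_of N) ` F)"
      by (meson IntI UN_I closure_of_subset_Int subsetD)
  qed
  ultimately show False using assms(2,3) interior_of_maximal by blast
qed

section \<open>Localised non-meagreness and continuous images of Polish spaces\<close>

definition meagre_part :: "'a topology \<Rightarrow> 'a set \<Rightarrow> 'a set" where
  "meagre_part T A = \<Union>{U. openin T U \<and> meagre_in T (A \<inter> U)}"

text \<open>The open set in which \<open>A\<close> is everywhere non-meagre, up to a nowhere dense error.\<close>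

definition ess_interior :: "'a topology \<Rightarrow> 'a set \<Rightarrow> 'a set" where
  "ess_interior T A = topspace T - T closure_of meagre_part T A"

lemma openin_meagre_part: "openin T (meagre_part T A)"
  unfolding meagre_part_def by blast

lemma openin_ess_interior: "openin T (ess_interior T A)"
  unfolding ess_interior_def by (simp add: openin_diff)

text \<open>The Banach category theorem for second countable spaces: the union defining
  \<open>meagre_part\<close> may be uncountable, but basic open sets contained in its members
  already cover it, and there are only countably many of these. So \<open>meagre_part T A\<close> is
  the largest open set in which \<open>A\<close> is meagre.\<close>

lemma meagre_in_Int_meagre_part:
  assumes "second_countable T"
  shows "meagre_in T (A \<inter> meagre_part T A)"
proof -
  obtain \<B> where \<B>: "countable \<B>" "\<And>V. V \<in> \<B> \<Longrightarrow> openin T V"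
    "\<And>U x. openin T U \<Longrightarrow> x \<in> U \<Longrightarrow> \<exists>V\<in>\<B>. x \<in> V \<and> V \<subseteq> U"
    using assms unfolding second_countable_def by metis
  let ?I = "{V\<in>\<B>. meagre_in T (A \<inter> V)}"
  have "meagre_in T (\<Union>V\<in>?I. A \<inter> V)"
    by (rule meagre_in_countable_Union) (use \<B>(1) in auto)
  moreover have "A \<inter> meagre_part T A \<subseteq> (\<Union>V\<in>?I. A \<inter> V)"
  proof
    fix x assume x: "x \<in> A \<inter> meagre_part T A"
    then obtain U where U: "openin T U" "meagre_in T (A \<inter> U)" "x \<in> U"
      unfolding meagre_part_def by blast
    then obtain V where V: "V \<in> \<B>" "x \<in> V" "V \<subseteq> U" using \<B>(3) by metis
    then have "V \<in> ?I" using U(2) by (auto intro: meagre_in_subset)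
    then show "x \<in> (\<Union>V\<in>?I. A \<inter> V)" using V(2) x by blast
  qed
  ultimately show ?thesis by (rule meagre_in_subset)
qed

lemma meagre_in_closure_diff_open:
  assumes "openin T U"
  shows "meagre_in T (T closure_of U - U)"
proof -
  have "closedin T (T closure_of U - U)"
    using assms by (simp add: closedin_diff)
  moreover have "T interior_of (T closure_of U - U) = {}"
  proof -
    have "V = {}" if V: "openin T V" "V \<subseteq> T closure_of U - U" for V
    proof -
      have "V \<inter> T closure_of U = {}" using V openin_Int_closure_of_eq_empty[OF V(1), of U] by blast
      then show ?thesis using V(2) by blast
    qed
    then show ?thesis by (meson interior_of_eq_empty)
  qed
  ultimately show ?thesis
    by (intro nowhere_dense_imp_meagre_in) (simp add: nowhere_dense_in_def closure_of_closedin)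
qed

lemma meagre_in_diff_ess_interior:
  assumes "second_countable T" "A \<subseteq> topspace T"
  shows "meagre_in T (A - ess_interior T A)"
proof -
  have "A - ess_interior T A \<subseteq> A \<inter> meagre_part T A \<union> (T closure_of meagre_part T A - meagre_part T A)"
    using assms(2) unfolding ess_interior_def by blast
  then show ?thesis
    using meagre_in_Int_meagre_part[OF assms(1)] meagre_in_closure_diff_open[OF openin_meagre_part]
    by (meson meagre_in_Un meagre_in_subset)
qed

lemma nonmeagre_in_Int_ess_interior:
  assumes "openin T U" "x \<in> U" "x \<in> ess_interior T A"
  shows "\<not> meagre_in T (A \<inter> U)"
proof
  assume "meagre_in T (A \<inter> U)"
  then have "U \<subseteq> meagre_part T A" using assms(1) unfolding meagre_part_def by blast
  then have "x \<in> T closure_of meagre_part T A"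
    using assms(1,2) by (meson closure_of_subset openin_meagre_part openin_subset subsetD)
  then show False using assms(3) unfolding ess_interior_def by blast
qed

text \<open>Outside the closure of the union on the right, \<open>A\<close> is covered by the meagre
  sets \<open>B i - ess_interior T (B i)\<close>. An open part of \<open>ess_interior T A\<close> in
  which \<open>A\<close> is meagre is empty, so the difference lies in the boundary of an open
  set.\<close>

lemma meagre_in_ess_interior_diff_UN:
  assumes "second_countable T" "countable I" "A \<subseteq> (\<Union>i\<in>I. B i)" "A \<subseteq> topspace T"
    and "\<And>i. i \<in> I \<Longrightarrow> B i \<subseteq> topspace T"
  shows "meagre_in T (ess_interior T A - (\<Union>i\<in>I. ess_interior T (B i)))"
proof -
  let ?U = "\<Union>i\<in>I. ess_interior T (B i)"
  let ?O = "ess_interior T A - T closure_of ?U"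
  have U: "openin T ?U" by (intro openin_Union) (auto intro: openin_ess_interior)
  have O: "openin T ?O" by (simp add: openin_diff openin_ess_interior)
  have "A \<inter> ?O \<subseteq> (\<Union>i\<in>I. B i - ess_interior T (B i))"
  proof
    fix x assume x: "x \<in> A \<inter> ?O"
    then obtain i where i: "i \<in> I" "x \<in> B i" using assms(3) by blast
    have "x \<notin> ?U" using x U by (meson DiffD2 IntD2 closure_of_subset openin_subset subsetD)
    then show "x \<in> (\<Union>i\<in>I. B i - ess_interior T (B i))" using i by blast
  qed
  moreover have "meagre_in T (\<Union>i\<in>I. B i - ess_interior T (B i))"
    using assms(1,2,5) by (intro meagre_in_countable_Union meagre_in_diff_ess_interior) auto
  ultimately have "meagre_in T (A \<inter> ?O)" by (meson meagre_in_subset)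
  then have "?O = {}" using nonmeagre_in_Int_ess_interior[OF O] by blast
  then have "ess_interior T A - ?U \<subseteq> T closure_of ?U - ?U" by blast
  then show ?thesis using meagre_in_closure_diff_open[OF U] by (rule meagre_in_subset[rotated])
qed

text \<open>Away from a meagre set, a point of \<open>ess_interior Y (f ` X)\<close> can be followed down a scheme
  of nested closed balls along which it stays in the essential interior of the image; completeness
  then yields a preimage. This replaces the Baire property of analytic sets.\<close>

lemma nonmeagre_image_comeagre_somewhere:
  assumes X: "completely_metrizable_space X" "second_countable X"
    and Y: "Hausdorff_space Y" "second_countable Y"
    and f: "continuous_map X Y f" and nm: "\<not> meagre_in Y (f ` topspace X)"
  shows "\<exists>U. openin Y U \<and> U \<noteq> {} \<and> meagre_in Y (U - f ` topspace X)"
proof -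
  obtain M d where "Metric_space M d" and comp: "Metric_space.mcomplete M d"
    and Xeq: "X = Metric_space.mtopology M d"
    using X(1) unfolding completely_metrizable_space_def by blast
  interpret Metric_space M d by fact
  obtain C where C: "countable C" "C \<subseteq> M" "mtopology closure_of C = M"
    using second_countable_imp_separable_space[OF X(2)] unfolding separable_space_def Xeq by auto
  have M: "topspace X = M" by (simp add: Xeq)
  have "M \<noteq> {}" using nm M by auto
  \<comment> \<open>Entry i of \<open>s\<close> is the centre of a closed ball of radius (1/2)^i.
    Density of \<open>C\<close> ensures that the one-step extensions of \<open>s\<close> cover
    \<open>F s\<close>.\<close>
  define F where "F s = {x \<in> M. \<forall>i<length s. d (s ! i) x \<le> (1/2) ^ i}" for s
  let ?E = "\<lambda>s. ess_interior Y (f ` F s)"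
  have FM: "F s \<subseteq> M" for s by (auto simp: F_def)
  have fF: "f ` F s \<subseteq> topspace Y" for s
    using FM f M by (meson continuous_map_image_subset_topspace image_mono order_trans subset_refl)
  have Fsplit: "F s \<subseteq> (\<Union>c\<in>C. F (s @ [c]))" for s
  proof
    fix x assume x: "x \<in> F s"
    then have "x \<in> mtopology closure_of C" using FM C by auto
    then obtain c where "c \<in> C" "c \<in> mball x ((1/2) ^ length s)"
      unfolding metric_closure_of by (auto dest!: spec[of _ "(1/2) ^ length s"])
    then have "x \<in> F (s @ [c])"
      using x by (auto simp: F_def nth_append less_Suc_eq commute)
    then show "x \<in> (\<Union>c\<in>C. F (s @ [c]))" using \<open>c \<in> C\<close> by blast
  qed
  have lists: "countable (lists C)" using C(1) by simp
  \<comment> \<open>\<open>N\<close> collects the points at which the descent gets stuck: they are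
    in the essential interior belonging to \<open>s\<close> but in that of no one-step extension of
    \<open>s\<close>.\<close>
  define N where "N = (\<Union>s\<in>lists C. ?E s - (\<Union>c\<in>C. ?E (s @ [c])))"
  have N: "meagre_in Y N"
    unfolding N_def
  proof (rule meagre_in_countable_Union[OF lists])
    fix s show "meagre_in Y (?E s - (\<Union>c\<in>C. ?E (s @ [c])))"
      using Fsplit[of s] by (intro meagre_in_ess_interior_diff_UN[OF Y(2) C(1) _ fF fF]) blast
  qed
  have F0: "F [] = M" by (simp add: F_def)
  have "?E [] - f ` topspace X \<subseteq> N"
  proof
    fix y assume y: "y \<in> ?E [] - f ` topspace X"
    show "y \<in> N"
    proof (rule ccontr)
      assume nN: "y \<notin> N"
      have step: "\<exists>c\<in>C. y \<in> ?E (s @ [c])" if "s \<in> lists C" "y \<in> ?E s" for s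
        using nN that unfolding N_def by blast
      have "\<exists>S. \<forall>n. (S n \<in> lists C \<and> length (S n) = n \<and> y \<in> ?E (S n)) \<and> (\<exists>c. S (Suc n) = S n @ [c])"
      proof (rule dependent_nat_choice)
        show "\<exists>s. s \<in> lists C \<and> length s = 0 \<and> y \<in> ?E s" using y by auto
        fix s n assume "s \<in> lists C \<and> length s = n \<and> y \<in> ?E s"
        then obtain c where "c \<in> C" "y \<in> ?E (s @ [c])" "s \<in> lists C" "length s = n"
          using step[of s] by blast
        then show "\<exists>t. (t \<in> lists C \<and> length t = Suc n \<and> y \<in> ?E t) \<and> (\<exists>c. t = s @ [c])"
          by (intro exI[of _ "s @ [c]"]) simp
      qed
      then obtain S where S: "\<And>n. S n \<in> lists C" "\<And>n. length (S n) = n" "\<And>n. y \<in> ?E (S n)"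
        "\<And>n. \<exists>c. S (Suc n) = S n @ [c]" by blast
      \<comment> \<open>Only this weak consequence of non-meagreness is needed below: every
        \<open>F (S n)\<close> contains points mapped arbitrarily close to \<open>y\<close>.\<close>
      have nonempty: "\<exists>x\<in>F (S n). f x \<in> O'" if O': "openin Y O'" "y \<in> O'" for n O'
      proof -
        have "\<not> meagre_in Y (f ` F (S n) \<inter> O')" using nonmeagre_in_Int_ess_interior[OF O' S(3)] .
        then have "f ` F (S n) \<inter> O' \<noteq> {}" by (metis meagre_in_empty)
        then show ?thesis by blast
      qed
      have dec: "F (S n) \<subseteq> F (S m)" if "m \<le> n" for m n
        using that
      proof (induction rule: dec_induct)
        case (step n)
        have "F (S (Suc n)) \<subseteq> F (S n)"
        proof -
          obtain c where c: "S (Suc n) = S n @ [c]" using S(4) by blast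
          have "d (S n ! i) x \<le> (1/2) ^ i" if "x \<in> F (S n @ [c])" "i < length (S n)" for x i
            using that unfolding F_def by (auto dest!: spec[of _ i] simp: nth_append)
          then show ?thesis unfolding c using FM by (fastforce simp: F_def)
        qed
        then show ?case using step by blast
      qed simp
      have yY: "y \<in> topspace Y" using y by (simp add: ess_interior_def)
      have "\<exists>x. \<forall>n. x n \<in> F (S n)" using nonempty[OF openin_topspace yY] by (intro choice) blast
      then obtain x where x: "\<And>n. x n \<in> F (S n)" by blast
      \<comment> \<open>The last centre of \<open>S (Suc n)\<close> has index n, hence radius
        (1/2)^n; the diameter is at most twice that.\<close>
      have close: "d u v \<le> 2 * (1/2) ^ n" if "u \<in> F (S (Suc n))" "v \<in> F (S (Suc n))" for u v n
      proof -
        have n: "S (Suc n) ! n \<in> M"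
          using S(1,2)[of "Suc n"] C(2) by (metis in_listsD lessI nth_mem subsetD)
        then have "d u v \<le> d (S (Suc n) ! n) u + d (S (Suc n) ! n) v"
          using that FM n triangle[of u "S (Suc n) ! n" v] commute[of u "S (Suc n) ! n"] by auto
        moreover have "d (S (Suc n) ! n) u \<le> (1/2) ^ n" "d (S (Suc n) ! n) v \<le> (1/2) ^ n"
          using that S(2) by (auto simp: F_def)
        ultimately show ?thesis by linarith
      qed
      have "MCauchy x"
        unfolding MCauchy_def
      proof (intro conjI strip)
        show "range x \<subseteq> M" using x FM by blast
        fix e :: real assume "e > 0"
        then obtain n where n: "(1/2) ^ n < e / 2"
          using real_arch_pow_inv[of "e/2" "1/2"] by auto
        have "d (x i) (x j) < e" if "Suc n \<le> i" "Suc n \<le> j" for i j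
          using close[of "x i" n "x j"] x dec that n by (smt (verit) subsetD field_sum_of_halves)
        then show "\<exists>N. \<forall>i j. N \<le> i \<longrightarrow> N \<le> j \<longrightarrow> d (x i) (x j) < e" by blast
      qed
      then obtain z where z: "limitin mtopology x z sequentially"
        using comp unfolding mcomplete_def by blast
      then have zM: "z \<in> M" by (simp add: limitin_mspace)
      \<comment> \<open>As \<open>y\<close> is outside the image, \<open>f z\<close> and
        \<open>y\<close> can be separated. This is absurd: a late \<open>F (S (Suc n))\<close> lies
        in a ball around \<open>z\<close> that is mapped into \<open>O1\<close>, yet it contains a
        point mapped into \<open>O2\<close>.\<close>
      have "f z \<noteq> y" using y zM M by blast
      moreover have "f z \<in> topspace Y" using f zM M by (metis continuous_map_image_subset_topspace image_subset_iff)
      ultimately obtain O1 O2 where O: "openin Y O1" "openin Y O2" "f z \<in> O1" "y \<in> O2" "disjnt O1 O2"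
        using Y(1) yY unfolding Hausdorff_space_def by metis
      have "openin mtopology {v \<in> M. f v \<in> O1}"
        using openin_continuous_map_preimage[OF f O(1)] M Xeq by auto
      then obtain r where r: "r > 0" "mball z r \<subseteq> {v \<in> M. f v \<in> O1}"
        using O(3) zM unfolding openin_mtopology by blast
      obtain n where n: "(1/2) ^ n < r / 4" using real_arch_pow_inv[of "r/4" "1/2"] r(1) by auto
      obtain K where K: "\<And>m. m \<ge> K \<Longrightarrow> d (x m) z < r / 2"
        using z r(1) unfolding limitin_metric eventually_sequentially
        by (metis half_gt_zero)
      obtain w where w: "w \<in> F (S (Suc n))" "f w \<in> O2" using nonempty[OF O(2,4)] by blast
      define m where "m = max K (Suc n)"
      have "d (x m) z < r / 2" using K unfolding m_def by simp
      moreover have "d (x m) w \<le> 2 * (1/2) ^ n"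
        using close[OF _ w(1)] x[of m] dec[of "Suc n" m] unfolding m_def by auto
      moreover have "d z w \<le> d (x m) z + d (x m) w"
        using zM w(1) x[of m] FM triangle[of z "x m" w] commute[of z "x m"] by auto
      ultimately have "w \<in> mball z r" using n zM w(1) FM by auto
      then show False using r(2) w(2) O(5) unfolding disjnt_def by blast
    qed
  qed
  then have "meagre_in Y (?E [] - f ` topspace X)" using N by (rule meagre_in_subset[rotated])
  moreover have "?E [] \<noteq> {}"
    using nm meagre_in_diff_ess_interior[OF Y(2) fF, of "[]"] F0 M by auto
  ultimately show ?thesis using openin_ess_interior by blast
qed

section \<open>Slices of comeagre sets\<close>

abbreviation power_top :: "'a topology \<Rightarrow> nat \<Rightarrow> (nat \<Rightarrow> 'a) topology" where
  "power_top T n \<equiv> product_topology (\<lambda>_. T) {..<n}"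

lemma PiE_fun_upd_lessThan_Suc:
  "x \<in> PiE {..<n} (\<lambda>_. S) \<Longrightarrow> y \<in> S \<Longrightarrow> x(n := y) \<in> PiE {..<Suc n} (\<lambda>_. S)"
  by (auto simp: PiE_iff extensional_def less_Suc_eq)

lemma continuous_map_power_top_component:
  "k < n \<Longrightarrow> continuous_map (power_top T n) T (\<lambda>x. x k)"
  using continuous_map_product_projection[of k "{..<n}" "\<lambda>_. T"] by simp

lemma continuous_map_power_top_append:
  assumes "y \<in> topspace T"
  shows "continuous_map (power_top T n) (power_top T (Suc n)) (\<lambda>x. x(n := y))"
  unfolding continuous_map_componentwise
proof (intro conjI ballI)
  show "(\<lambda>x. x(n := y)) ` topspace (power_top T n) \<subseteq> extensional {..<Suc n}"
    by (auto simp: extensional_def PiE_iff)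
  fix k assume "k \<in> {..<Suc n}"
  show "continuous_map (power_top T n) T (\<lambda>x. (x(n := y)) k)"
  proof (cases "k = n")
    case True then show ?thesis using assms by simp
  next
    case False
    then have "k \<in> {..<n}" using \<open>k \<in> {..<Suc n}\<close> by simp
    then show ?thesis using False by (simp add: continuous_map_power_top_component)
  qed
qed

lemma continuous_map_power_top_restrict:
  "continuous_map (power_top T (Suc n)) (power_top T n) (\<lambda>z. restrict z {..<n})"
  unfolding continuous_map_componentwise
proof (intro conjI ballI)
  show "(\<lambda>z. restrict z {..<n}) ` topspace (power_top T (Suc n)) \<subseteq> extensional {..<n}" by auto
  fix k assume "k \<in> {..<n}"
  then show "continuous_map (power_top T (Suc n)) T (\<lambda>z. restrict z {..<n} k)"
    by (simp add: continuous_map_power_top_component)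
qed

text \<open>A slice of an open set is open, so only its density is at issue, and this is tested on a
  countable basis. For a fixed non-empty basic \<open>V\<close>, the points whose slice meets
  \<open>V\<close> form an open set; it is dense because \<open>U\<close> meets every open box with
  last side \<open>V\<close>.\<close>

lemma comeagre_in_slice_open_dense:
  assumes T: "second_countable T"
    and U: "openin (power_top T (Suc n)) U" "power_top T (Suc n) closure_of U = topspace (power_top T (Suc n))"
  shows "comeagre_in (power_top T n)
    {x \<in> topspace (power_top T n). comeagre_in T {y \<in> topspace T. x(n := y) \<in> U}}"
proof -
  let ?X = "power_top T n" and ?X' = "power_top T (Suc n)"
  obtain \<B> where \<B>: "countable \<B>" "\<And>V. V \<in> \<B> \<Longrightarrow> openin T V"
    "\<And>W x. openin T W \<Longrightarrow> x \<in> W \<Longrightarrow> \<exists>V\<in>\<B>. x \<in> V \<and> V \<subseteq> W"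
    using T unfolding second_countable_def by metis
  define P where "P V = (\<Union>y\<in>V. {x \<in> topspace ?X. x(n := y) \<in> U})" for V
  have "comeagre_in ?X (P V)" if V: "V \<in> \<B> - {{}}" for V
  proof (rule comeagre_in_open_dense)
    have VT: "V \<subseteq> topspace T" using V \<B>(2) openin_subset by blast
    show "openin ?X (P V)"
      unfolding P_def
    proof (rule openin_Union, elim imageE)
      fix S y assume "y \<in> V" and S: "S = {x \<in> topspace ?X. x(n := y) \<in> U}"
      then have "y \<in> topspace T" using VT by blast
      then show "openin ?X S"
        unfolding S by (rule openin_continuous_map_preimage[OF continuous_map_power_top_append U(1)])
    qed
    show "?X closure_of P V = topspace ?X"
      unfolding dense_intersects_open
    proof (intro allI impI)
      fix O' assume O': "openin ?X O' \<and> O' \<noteq> {}"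
      obtain x y where xy: "x \<in> O'" "y \<in> V" using O' V by blast
      let ?W = "{z \<in> topspace ?X'. restrict z {..<n} \<in> O'} \<inter> {z \<in> topspace ?X'. z n \<in> V}"
      have "openin ?X' {z \<in> topspace ?X'. z n \<in> V}"
        using V \<B>(2) by (intro openin_continuous_map_preimage[where Y = T]) (auto intro: continuous_map_power_top_component)
      then have W: "openin ?X' ?W"
        using openin_continuous_map_preimage[OF continuous_map_power_top_restrict conjunct1[OF O']]
        by (rule openin_Int[rotated])
      have xX: "x \<in> topspace ?X" using xy O' openin_subset by blast
      then have "restrict (x(n := y)) {..<n} = x"
        by (auto simp: PiE_iff extensional_def restrict_def)
      moreover have "x(n := y) \<in> topspace ?X'"
        using xX xy VT PiE_fun_upd_lessThan_Suc[of x n "topspace T" y] by auto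
      ultimately have "x(n := y) \<in> ?W" using xy by simp
      then obtain z where z: "z \<in> ?W" "z \<in> U"
        using W U(2) unfolding dense_intersects_open by blast
      have zn: "(restrict z {..<n})(n := z n) = z"
        using z(1) by (auto simp: PiE_iff extensional_def restrict_def fun_eq_iff)
      have "restrict z {..<n} \<in> topspace ?X" using z(1) O' openin_subset by blast
      then have "restrict z {..<n} \<in> P V" 
        unfolding P_def using z zn by (intro UN_I[of "z n"]) (simp_all only: mem_Collect_eq Int_iff simp_thms)
      then show "P V \<inter> O' \<noteq> {}" using z(1) by blast
    qed
  qed
  then have "comeagre_in ?X (topspace ?X \<inter> (\<Inter>V\<in>\<B> - {{}}. P V))"
    using \<B>(1) by (intro comeagre_in_countable_INT) auto
  then show ?thesis
  proof (rule comeagre_in_mono)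
    show "topspace ?X \<inter> (\<Inter>V\<in>\<B> - {{}}. P V) \<subseteq> {x \<in> topspace ?X. comeagre_in T {y \<in> topspace T. x(n := y) \<in> U}}"
    proof (intro subsetI CollectI conjI)
      fix x assume x: "x \<in> topspace ?X \<inter> (\<Inter>V\<in>\<B> - {{}}. P V)"
      then show xX: "x \<in> topspace ?X" by blast
      show "comeagre_in T {y \<in> topspace T. x(n := y) \<in> U}"
      proof (rule comeagre_in_open_dense)
        have "continuous_map T ?X' (\<lambda>y. x(n := y))"
          unfolding continuous_map_componentwise
        proof (intro conjI ballI)
          show "(\<lambda>y. x(n := y)) ` topspace T \<subseteq> extensional {..<Suc n}"
            using xX by (auto simp: extensional_def PiE_iff)
          fix k assume "k \<in> {..<Suc n}"
          then show "continuous_map T T (\<lambda>y. (x(n := y)) k)"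
            using xX by (cases "k = n") (auto simp: PiE_iff)
        qed
        then show "openin T {y \<in> topspace T. x(n := y) \<in> U}"
          using U(1) by (rule openin_continuous_map_preimage)
        show "T closure_of {y \<in> topspace T. x(n := y) \<in> U} = topspace T"
          unfolding dense_intersects_open
        proof (intro allI impI)
          fix W assume W: "openin T W \<and> W \<noteq> {}"
          then obtain y where "y \<in> W" by blast
          then obtain V where V: "V \<in> \<B>" "y \<in> V" "V \<subseteq> W" using \<B>(3) W by metis
          then have "x \<in> P V" using x by auto
          then obtain y' where "y' \<in> V" "x(n := y') \<in> U" unfolding P_def by blast
          moreover have "y' \<in> topspace T" using \<open>y' \<in> V\<close> V W openin_subset by blast
          ultimately show "{y \<in> topspace T. x(n := y) \<in> U} \<inter> W \<noteq> {}" using V by blast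
        qed
      qed
    qed
  qed auto
qed

text \<open>One half of the Kuratowski--Ulam theorem.\<close>

lemma comeagre_in_slice:
  assumes T: "second_countable T" and E: "comeagre_in (power_top T (Suc n)) E"
  shows "comeagre_in (power_top T n)
    {x \<in> topspace (power_top T n). comeagre_in T {y \<in> topspace T. x(n := y) \<in> E}}"
proof -
  let ?X = "power_top T n" and ?X' = "power_top T (Suc n)"
  obtain \<U> where \<U>: "countable \<U>" "\<And>U. U \<in> \<U> \<Longrightarrow> openin ?X' U \<and> ?X' closure_of U = topspace ?X'"
    "topspace ?X' \<inter> \<Inter>\<U> \<subseteq> E"
    using comeagre_in_obtain_open_dense[OF E] by metis
  let ?S = "\<lambda>U. {x \<in> topspace ?X. comeagre_in T {y \<in> topspace T. x(n := y) \<in> U}}"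
  have "comeagre_in ?X (topspace ?X \<inter> (\<Inter>U\<in>\<U>. ?S U))"
    using \<U> by (intro comeagre_in_countable_INT comeagre_in_slice_open_dense[OF T]) auto
  then show ?thesis
  proof (rule comeagre_in_mono)
    show "topspace ?X \<inter> (\<Inter>U\<in>\<U>. ?S U) \<subseteq> ?S E"
    proof
      fix x assume x: "x \<in> topspace ?X \<inter> (\<Inter>U\<in>\<U>. ?S U)"
      have "comeagre_in T (topspace T \<inter> (\<Inter>U\<in>\<U>. {y \<in> topspace T. x(n := y) \<in> U}))"
        using x \<U>(1) by (intro comeagre_in_countable_INT) auto
      moreover have "topspace T \<inter> (\<Inter>U\<in>\<U>. {y \<in> topspace T. x(n := y) \<in> U}) \<subseteq> {y \<in> topspace T. x(n := y) \<in> E}"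
        using x \<U>(3) PiE_fun_upd_lessThan_Suc[of x n "topspace T"] by fastforce
      ultimately have "comeagre_in T {y \<in> topspace T. x(n := y) \<in> E}" by (rule comeagre_in_mono) auto
      then show "x \<in> ?S E" using x by blast
    qed
  qed auto
qed

text \<open>Requiring once that almost all extensions of a tuple stay in the family shrinks the
  family, and the requirement may then fail for the smaller one. It is therefore iterated countably
  often, and the intersection is taken: refinement k + 1 of n-tuples controls refinement k of
  (n+1)-tuples, so a tuple surviving all refinements has comeagre many extensions surviving all of
  them.\<close>

lemma comeagre_in_hereditary:
  assumes T: "second_countable T" and \<Omega>: "\<And>n. comeagre_in (power_top T n) (\<Omega> n)"
  shows "\<exists>C. \<forall>n. C n \<subseteq> \<Omega> n \<and> comeagre_in (power_top T n) (C n) \<and>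
    (\<forall>x\<in>C n. comeagre_in T {y \<in> topspace T. x(n := y) \<in> C (Suc n)})"
proof -
  define D where "D = rec_nat \<Omega> (\<lambda>_ D n. {x \<in> D n. comeagre_in T {y \<in> topspace T. x(n := y) \<in> D (Suc n)}})"
  have D0: "D 0 = \<Omega>"
    and DS: "D (Suc k) n = {x \<in> D k n. comeagre_in T {y \<in> topspace T. x(n := y) \<in> D k (Suc n)}}" for k n
    by (simp_all add: D_def)
  have D: "comeagre_in (power_top T n) (D k n)" for k n
  proof (induction k arbitrary: n)
    case (Suc k)
    have "D (Suc k) n = D k n \<inter> {x \<in> topspace (power_top T n). comeagre_in T {y \<in> topspace T. x(n := y) \<in> D k (Suc n)}}"
      using Suc[of n] unfolding DS comeagre_in_def by blast
    then show ?case using comeagre_in_Int[OF Suc comeagre_in_slice[OF T Suc]] by simp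
  qed (simp add: D0 \<Omega>)
  define C where "C n = topspace (power_top T n) \<inter> (\<Inter>k\<in>UNIV. D k n)" for n
  show ?thesis
  proof (intro exI[of _ C] allI conjI ballI)
    show "C n \<subseteq> \<Omega> n" for n unfolding C_def D0[symmetric] by blast
    show "comeagre_in (power_top T n) (C n)" for n
      unfolding C_def using D by (intro comeagre_in_countable_INT) auto
    fix n x assume x: "x \<in> C n"
    have "comeagre_in T (topspace T \<inter> (\<Inter>k\<in>UNIV. {y \<in> topspace T. x(n := y) \<in> D k (Suc n)}))"
    proof (rule comeagre_in_countable_INT)
      fix k :: nat
      have "x \<in> D (Suc k) n" using x unfolding C_def by blast
      then show "comeagre_in T {y \<in> topspace T. x(n := y) \<in> D k (Suc n)}" unfolding DS by blast
    qed simp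
    moreover have "topspace T \<inter> (\<Inter>k\<in>UNIV. {y \<in> topspace T. x(n := y) \<in> D k (Suc n)})
        \<subseteq> {y \<in> topspace T. x(n := y) \<in> C (Suc n)}"
    proof
      fix y assume y: "y \<in> topspace T \<inter> (\<Inter>k\<in>UNIV. {y \<in> topspace T. x(n := y) \<in> D k (Suc n)})"
      then have "\<And>k. x(n := y) \<in> D k (Suc n)" "y \<in> topspace T" by auto
      moreover from this have "x(n := y) \<in> topspace (power_top T (Suc n))"
        using D[of "Suc n" 0] unfolding comeagre_in_def by blast
      ultimately show "y \<in> {y \<in> topspace T. x(n := y) \<in> C (Suc n)}" unfolding C_def by blast
    qed
    ultimately show "comeagre_in T {y \<in> topspace T. x(n := y) \<in> C (Suc n)}"
      by (rule comeagre_in_mono) auto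
  qed
qed

section \<open>Closed groups of isometries as Polish groups\<close>

lemma second_countable_euclidean [simp]:
  "second_countable (euclidean :: 'a::second_countable_topology topology)"
proof -
  obtain B :: "'a set set" where "countable B" "topological_basis B"
    using ex_countable_basis by blast
  then show ?thesis
    unfolding second_countable_def
    by (metis open_openin topological_basisE topological_basis_open)
qed

lemma second_countable_prod_topology:
  assumes "second_countable X" "second_countable Y"
  shows "second_countable (prod_topology X Y)"
proof -
  obtain \<A> where \<A>: "countable \<A>" "\<And>V. V \<in> \<A> \<Longrightarrow> openin X V"
    "\<And>U x. openin X U \<Longrightarrow> x \<in> U \<Longrightarrow> \<exists>V\<in>\<A>. x \<in> V \<and> V \<subseteq> U"
    using assms(1) unfolding second_countable_def by metis
  obtain \<B> where \<B>: "countable \<B>" "\<And>V. V \<in> \<B> \<Longrightarrow> openin Y V"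
    "\<And>U x. openin Y U \<Longrightarrow> x \<in> U \<Longrightarrow> \<exists>V\<in>\<B>. x \<in> V \<and> V \<subseteq> U"
    using assms(2) unfolding second_countable_def by metis
  show ?thesis
    unfolding second_countable_def
  proof (intro exI conjI ballI allI impI)
    show "countable ((\<lambda>(A, B). A \<times> B) ` (\<A> \<times> \<B>))" using \<A>(1) \<B>(1) by simp
    show "openin (prod_topology X Y) V" if "V \<in> (\<lambda>(A, B). A \<times> B) ` (\<A> \<times> \<B>)" for V
      using that \<A>(2) \<B>(2) by (auto simp: openin_prod_Times_iff)
    fix U p assume U: "openin (prod_topology X Y) U \<and> p \<in> U"
    obtain x y where p: "p = (x, y)" by (cases p)
    then obtain A B where AB: "openin X A" "openin Y B" "x \<in> A" "y \<in> B" "A \<times> B \<subseteq> U"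
      using U unfolding openin_prod_topology_alt by metis
    obtain A' where "A' \<in> \<A>" "x \<in> A'" "A' \<subseteq> A" using \<A>(3)[OF AB(1,3)] by blast
    moreover obtain B' where "B' \<in> \<B>" "y \<in> B'" "B' \<subseteq> B" using \<B>(3)[OF AB(2,4)] by blast
    ultimately show "\<exists>V\<in>(\<lambda>(A, B). A \<times> B) ` (\<A> \<times> \<B>). p \<in> V \<and> V \<subseteq> U"
      using AB(5) p by (intro bexI[of _ "A' \<times> B'"]) auto
  qed
qed

lemma continuous_map_dist:
  fixes f g :: "'b \<Rightarrow> 'a::metric_space"
  assumes "continuous_map X euclidean f" "continuous_map X euclidean g"
  shows "continuous_map X euclideanreal (\<lambda>x. dist (f x) (g x))"
proof -
  have "continuous_map X (euclidean :: ('a \<times> 'a) topology) (\<lambda>x. (f x, g x))"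
    using continuous_map_pairedI[OF assms] by simp
  moreover have "continuous_map euclidean euclideanreal (\<lambda>p :: 'a \<times> 'a. dist (fst p) (snd p))"
    by (simp add: continuous_on_dist continuous_on_fst continuous_on_snd)
  ultimately show ?thesis
    using continuous_map_compose[of X euclidean "\<lambda>x. (f x, g x)" euclideanreal "\<lambda>p. dist (fst p) (snd p)"]
    by (simp add: o_def)
qed

lemma closedin_dist_le:
  fixes f g :: "'b \<Rightarrow> 'a::metric_space"
  assumes "continuous_map X euclidean f" "continuous_map X euclidean g"
  shows "closedin X {x \<in> topspace X. dist (f x) (g x) \<le> c}"
  using closedin_continuous_map_preimage[OF continuous_map_dist[OF assms], of "{..c}"] by simp

lemma openin_dist_less:
  fixes f g :: "'b \<Rightarrow> 'a::metric_space"
  assumes "continuous_map X euclidean f" "continuous_map X euclidean g"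
  shows "openin X {x \<in> topspace X. dist (f x) (g x) < c}"
  using openin_continuous_map_preimage[OF continuous_map_dist[OF assms], of "{..<c}"] by simp

lemma continuous_map_euclidean_metric:
  fixes f :: "'b \<Rightarrow> 'a::metric_space"
  shows "continuous_map X euclidean f \<longleftrightarrow>
    (\<forall>x\<in>topspace X. \<forall>\<epsilon>>0. \<exists>U. openin X U \<and> x \<in> U \<and> (\<forall>y\<in>U. dist (f x) (f y) < \<epsilon>))"
  using Met_TC.continuous_map_to_metric[of X f] by simp

section \<open>Powers of sets and uniform closeness of maps\<close>

lemma set_power_Suc_0: "s \<in> S \<Longrightarrow> s \<in> set_power S (Suc 0)"
  by force

lemma set_power_mono:
  assumes "S \<subseteq> T" shows "set_power S k \<subseteq> set_power T k"
proof (induction k)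
  case (Suc k)
  then show ?case using assms by (simp, blast)
qed simp

lemma set_power_comp:
  assumes "t \<in> set_power S n"
  shows "s \<in> set_power S m \<Longrightarrow> s \<circ> t \<in> set_power S (m + n)"
proof (induction m arbitrary: s)
  case (Suc m)
  then obtain a b where ab: "s = a \<circ> b" "a \<in> S" "b \<in> set_power S m" by auto
  then have "b \<circ> t \<in> set_power S (m + n)" using Suc by blast
  moreover have "s \<circ> t = a \<circ> (b \<circ> t)" using ab(1) by (simp add: o_assoc)
  ultimately show ?case using ab(2) unfolding add_Suc set_power.simps by blast
qed (use assms in simp)

text \<open>A real-valued substitute for \<open>unif_dist\<close>, which may be infinite. The
  non-strict bound makes the relation stable under pointwise limits and lets errors be added;
  converting to and from \<open>unif_dist\<close> costs only strictness.\<close>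

definition near :: "real \<Rightarrow> ('b \<Rightarrow> 'a::metric_space) \<Rightarrow> ('b \<Rightarrow> 'a) \<Rightarrow> bool" where
  "near r g h \<longleftrightarrow> (\<forall>x. dist (g x) (h x) \<le> r)"

lemma near_refl: "0 \<le> r \<Longrightarrow> near r g g"
  by (simp add: near_def)

lemma near_sym: "near r g h \<Longrightarrow> near r h g"
  by (simp add: near_def dist_commute)

lemma near_trans: "near r f g \<Longrightarrow> near s g h \<Longrightarrow> near (r + s) f h"
  unfolding near_def by (meson add_mono dist_triangle order_trans)

lemma near_mono: "near r f g \<Longrightarrow> r \<le> s \<Longrightarrow> near s f g"
  unfolding near_def by (meson order_trans)

lemma unif_dist_less_imp_near: "unif_dist g h < ereal \<epsilon> \<Longrightarrow> near \<epsilon> g h"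
  unfolding unif_dist_def near_def
  by (meson SUP_lessD UNIV_I ereal_less_eq(3) less_imp_le)

lemma near_imp_unif_dist_less: "near r g h \<Longrightarrow> r < \<epsilon> \<Longrightarrow> unif_dist g h < ereal \<epsilon>"
proof -
  assume "near r g h" "r < \<epsilon>"
  then have "unif_dist g h \<le> ereal r"
    unfolding unif_dist_def near_def by (intro SUP_least) simp
  then show ?thesis using \<open>r < \<epsilon>\<close> by (simp add: le_less_trans)
qed

definition conjugate :: "('a \<Rightarrow> 'a) \<Rightarrow> ('a \<Rightarrow> 'a) \<Rightarrow> 'a \<Rightarrow> 'a" where
  "conjugate k g = k \<circ> g \<circ> inv k"

section \<open>The group of isometries with the topology of pointwise convergence\<close>

locale closed_isometry_group =
  fixes G :: "('a::polish_space \<Rightarrow> 'a) set"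
  assumes closed_subgroup: "closed_subgroup_Iso G"
begin

lemma id_in [simp]: "id \<in> G"
  and comp_in [simp]: "g \<in> G \<Longrightarrow> h \<in> G \<Longrightarrow> g \<circ> h \<in> G"
  and inv_in [simp]: "g \<in> G \<Longrightarrow> inv g \<in> G"
  and isometry: "g \<in> G \<Longrightarrow> isometry g"
  using closed_subgroup by (auto simp: closed_subgroup_Iso_def is_subgroup_Iso_def Iso_def)

lemma dist_eq [simp]: "g \<in> G \<Longrightarrow> dist (g x) (g y) = dist x y"
  using isometry by (auto simp: isometry_def)

lemma bij: "g \<in> G \<Longrightarrow> bij g"
proof -
  assume g: "g \<in> G"
  then have "inj g" by (metis dist_eq dist_eq_0_iff injI)
  then show "bij g" using isometry[OF g] by (simp add: isometry_def bij_def)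
qed

lemma inv_f_eq [simp]: "g \<in> G \<Longrightarrow> inv g (g x) = x"
  and f_inv_eq [simp]: "g \<in> G \<Longrightarrow> g (inv g x) = x"
  and inv_inv [simp]: "g \<in> G \<Longrightarrow> inv (inv g) = g"
  using bij by (auto simp: bij_def surj_f_inv_f inv_inv_eq)

lemma inv_comp: "g \<in> G \<Longrightarrow> h \<in> G \<Longrightarrow> inv (g \<circ> h) = inv h \<circ> inv g"
  using bij by (simp add: o_inv_distrib)

lemma conjugate_in [simp]: "k \<in> G \<Longrightarrow> g \<in> G \<Longrightarrow> conjugate k g \<in> G"
  by (simp add: conjugate_def)

lemma conjugate_comp: "k \<in> G \<Longrightarrow> l \<in> G \<Longrightarrow> conjugate (k \<circ> l) g = conjugate k (conjugate l g)"
  by (simp add: conjugate_def inv_comp o_assoc)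

lemma conjugate_inv_conjugate [simp]: "k \<in> G \<Longrightarrow> conjugate (inv k) (conjugate k g) = g"
  and conjugate_conjugate_inv [simp]: "k \<in> G \<Longrightarrow> conjugate k (conjugate (inv k) g) = g"
  by (auto simp: conjugate_def fun_eq_iff)

lemma near_conjugate: "k \<in> G \<Longrightarrow> near r (conjugate k g) (conjugate k h) \<longleftrightarrow> near r g h"
  unfolding conjugate_def near_def by simp (metis inv_f_eq)

text \<open>Multiplying out by \<open>k\<close> eliminates \<open>inv k\<close>. On the right,
  \<open>k\<close> occurs only through its values, so the condition is visibly closed in
  \<open>k\<close> and passes to pointwise limits of conjugators.\<close>

lemma near_conjugate_iff: "k \<in> G \<Longrightarrow> near r (conjugate k g) h \<longleftrightarrow> near r (k \<circ> g) (h \<circ> k)"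
  unfolding conjugate_def near_def by simp (metis inv_f_eq f_inv_eq)

lemma topspace_tau [simp]: "topspace (tau G) = G"
  by (simp add: tau_def pointwise_top_def)

lemma continuous_map_eval: "continuous_map (tau G) euclidean (\<lambda>g. g x)"
  unfolding tau_def pointwise_top_def
  by (intro continuous_map_from_subtopology continuous_map_product_projection) auto

lemma continuous_map_tau:
  "continuous_map X (tau G) f \<longleftrightarrow>
    (\<forall>p\<in>topspace X. f p \<in> G) \<and> (\<forall>x. continuous_map X euclidean (\<lambda>p. f p x))"
  by (auto simp: tau_def pointwise_top_def continuous_map_in_subtopology continuous_map_componentwise_UNIV)

text \<open>Evaluation is jointly continuous because isometries are equicontinuous: moving the
  argument costs no more than the distance moved. Continuity of multiplication follows.\<close>

lemma continuous_map_apply: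
  assumes "continuous_map X (tau G) f" "continuous_map X euclidean u"
  shows "continuous_map X euclidean (\<lambda>p. f p (u p))"
  unfolding continuous_map_euclidean_metric
proof (intro ballI allI impI)
  fix p and \<epsilon> :: real assume p: "p \<in> topspace X" and "\<epsilon> > 0"
  then have e: "\<epsilon> / 2 > 0" by simp
  have "continuous_map X euclidean (\<lambda>q. f q (u p))" using assms(1) by (simp add: continuous_map_tau)
  then obtain U where U: "openin X U" "p \<in> U" "\<And>q. q \<in> U \<Longrightarrow> dist (f p (u p)) (f q (u p)) < \<epsilon> / 2"
    using p e unfolding continuous_map_euclidean_metric by meson
  obtain V where V: "openin X V" "p \<in> V" "\<And>q. q \<in> V \<Longrightarrow> dist (u p) (u q) < \<epsilon> / 2"
    using assms(2) p e unfolding continuous_map_euclidean_metric by meson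
  show "\<exists>U. openin X U \<and> p \<in> U \<and> (\<forall>q\<in>U. dist (f p (u p)) (f q (u q)) < \<epsilon>)"
  proof (intro exI conjI ballI)
    show "openin X (U \<inter> V)" "p \<in> U \<inter> V" using U V by auto
    fix q assume q: "q \<in> U \<inter> V"
    then have "f q \<in> G" using assms(1) U(1) openin_subset by (auto simp: continuous_map_tau)
    then have "dist (f q (u p)) (f q (u q)) < \<epsilon> / 2" using V q by simp
    then show "dist (f p (u p)) (f q (u q)) < \<epsilon>"
      using U(3)[of q] q dist_triangle[of "f p (u p)" "f q (u q)" "f q (u p)"] by simp
  qed
qed

text \<open>The distance of \<open>inv g x\<close> and \<open>inv h x\<close> equals that of
  \<open>h (inv g x)\<close> and \<open>x\<close>, which for fixed \<open>g\<close> depends on a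
  single value of \<open>h\<close>.\<close>

lemma continuous_map_inv: "continuous_map (tau G) (tau G) inv"
  unfolding continuous_map_tau
proof (intro conjI allI ballI)
  fix x show "continuous_map (tau G) euclidean (\<lambda>g. inv g x)"
    unfolding continuous_map_euclidean_metric
  proof (intro ballI allI impI)
    fix g and \<epsilon> :: real assume g: "g \<in> topspace (tau G)" and "\<epsilon> > 0"
    let ?U = "{h \<in> topspace (tau G). dist (h (inv g x)) x < \<epsilon>}"
    have "openin (tau G) ?U" by (intro openin_dist_less continuous_map_eval) auto
    moreover have "g \<in> ?U" using g \<open>\<epsilon> > 0\<close> by simp
    moreover have "dist (inv g x) (inv h x) < \<epsilon>" if "h \<in> ?U" for h
    proof -
      have "dist (inv g x) (inv h x) = dist (h (inv g x)) (h (inv h x))"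
        by (rule dist_eq[symmetric]) (use that in simp)
      then show ?thesis using that by simp
    qed
    ultimately show "\<exists>U. openin (tau G) U \<and> g \<in> U \<and> (\<forall>h\<in>U. dist (inv g x) (inv h x) < \<epsilon>)" by blast
  qed
qed simp

lemma continuous_map_mult:
  assumes "continuous_map X (tau G) f" "continuous_map X (tau G) g"
  shows "continuous_map X (tau G) (\<lambda>p. f p \<circ> g p)"
  using assms unfolding continuous_map_tau[of X "\<lambda>p. f p \<circ> g p"]
  by (auto simp: continuous_map_tau intro!: continuous_map_apply[OF assms(1)])

lemma homeomorphic_map_mult_left:
  assumes "k \<in> G" shows "homeomorphic_map (tau G) (tau G) (\<lambda>g. k \<circ> g)"
  unfolding homeomorphic_map_maps
proof (intro exI)
  have "continuous_map (tau G) (tau G) (\<lambda>g. k \<circ> g)" if "k \<in> G" for k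
    using continuous_map_mult[of "tau G" "\<lambda>_. k" "\<lambda>g. g"] that by simp
  then show "homeomorphic_maps (tau G) (tau G) (\<lambda>g. k \<circ> g) (\<lambda>g. inv k \<circ> g)"
    using assms by (auto simp: homeomorphic_maps_def o_assoc)
qed

lemma homeomorphic_map_conjugate:
  assumes "k \<in> G" shows "homeomorphic_map (tau G) (tau G) (conjugate k)"
  unfolding homeomorphic_map_maps
proof (intro exI)
  have "continuous_map (tau G) (tau G) (conjugate k)" if "k \<in> G" for k
    using continuous_map_mult[OF continuous_map_mult[of "tau G" "\<lambda>_. k" "\<lambda>g. g"], of "\<lambda>_. inv k"] that
    by (simp add: conjugate_def[abs_def])
  then show "homeomorphic_maps (tau G) (tau G) (conjugate k) (conjugate (inv k))"
    using assms by (auto simp: homeomorphic_maps_def)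
qed

text \<open>For finite \<open>Q\<close> and positive \<open>\<delta>\<close> these are
  neighbourhoods of the identity. The non-strict inequality makes them closed, so that local orbits
  become projections of closed sets.\<close>

definition basic_nbhd :: "'a set \<Rightarrow> real \<Rightarrow> ('a \<Rightarrow> 'a) set" where
  "basic_nbhd Q \<delta> = {v \<in> G. \<forall>q\<in>Q. dist (v q) q \<le> \<delta>}"

lemma closedin_basic_nbhd: "closedin (tau G) (basic_nbhd Q \<delta>)"
proof -
  have "basic_nbhd Q \<delta> = topspace (tau G) \<inter> (\<Inter>q\<in>Q. {v \<in> topspace (tau G). dist (v q) q \<le> \<delta>})"
    by (auto simp: basic_nbhd_def)
  moreover have "closedin (tau G) \<dots>"
    by (cases "Q = {}") (auto intro!: closedin_Inter closedin_Int closedin_dist_le continuous_map_eval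
        simp del: topspace_tau)
  ultimately show ?thesis by simp
qed

lemma basic_nbhd_subset_open:
  assumes U: "openin (tau G) U" "id \<in> U"
  obtains Q \<delta> where "finite Q" "\<delta> > 0" "basic_nbhd Q \<delta> \<subseteq> U"
proof -
  obtain W where W: "openin pointwise_top W" "U = W \<inter> G"
    using U(1) by (auto simp: tau_def openin_subtopology)
  then have "id \<in> W" using U(2) by blast
  then obtain A where "finite {i \<in> UNIV. A i \<noteq> topspace (euclidean :: 'a topology)}"
    "\<forall>i\<in>UNIV. openin (euclidean :: 'a topology) (A i)" "id \<in> Pi\<^sub>E UNIV A" "Pi\<^sub>E UNIV A \<subseteq> W"
    using iffD1[OF openin_product_topology_alt W(1)[unfolded pointwise_top_def], THEN bspec, OF \<open>id \<in> W\<close>]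
    by (elim exE conjE) (rule that; assumption)
  then have A: "finite {x. A x \<noteq> UNIV}" "\<And>x. open (A x)" "\<And>x. x \<in> A x" "Pi\<^sub>E UNIV A \<subseteq> W"
    by (auto simp: PiE_iff)
  let ?Q = "{x. A x \<noteq> UNIV}"
  have "\<forall>x. \<exists>d>0. cball x d \<subseteq> A x" using A(2,3) open_contains_cball by blast
  then obtain d where d: "\<And>x. d x > 0" "\<And>x. cball x (d x) \<subseteq> A x" by metis
  \<comment> \<open>The 1 keeps \<open>Min\<close> meaningful when no coordinate is
    constrained.\<close>
  define \<delta> where "\<delta> = Min (insert 1 (d ` ?Q))"
  have "\<delta> > 0" using A(1) d(1) by (auto simp: \<delta>_def)
  have \<delta>: "\<delta> \<le> d x" if "x \<in> ?Q" for x using A(1) that by (auto simp: \<delta>_def)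
  have "basic_nbhd ?Q \<delta> \<subseteq> U"
  proof
    fix v assume v: "v \<in> basic_nbhd ?Q \<delta>"
    have "v x \<in> A x" for x
    proof (cases "x \<in> ?Q")
      case True
      then have "dist (v x) x \<le> d x" using v \<delta>[OF True] unfolding basic_nbhd_def by fastforce
      then show ?thesis using d(2)[of x] by (auto simp: dist_commute)
    qed simp
    then have "v \<in> W" using A(4) by (auto simp: PiE_iff)
    then show "v \<in> U" using v W(2) by (simp add: basic_nbhd_def)
  qed
  then show thesis using that A(1) \<open>\<delta> > 0\<close> by blast
qed

text \<open>An element is coded by its values and those of its inverse on a dense sequence. The
  inverse is what makes the set of codes closed: a pointwise limit of surjective isometries need not
  be surjective, but the limit of the inverses supplies preimages.\<close>

lemma tau_Polish:
  shows completely_metrizable_tau: "completely_metrizable_space (tau G)"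
    and second_countable_tau: "second_countable (tau G)"
proof -
  obtain D :: "'a set" where D: "countable D" "\<And>X. open X \<Longrightarrow> X \<noteq> {} \<Longrightarrow> \<exists>d\<in>D. d \<in> X"
    by (metis countable_dense_setE)
  then have "D \<noteq> {}" using D(2)[of UNIV] by auto
  define q where "q = from_nat_into D"
  have q: "\<exists>i. dist (q i) x < e" if "e > 0" for x e
    using D(2)[of "ball x e"] that range_from_nat_into[OF \<open>D \<noteq> {}\<close> D(1)] unfolding q_def
    by (force simp: dist_commute)
  define \<Psi> where "\<Psi> g = (\<lambda>i. g (q i), \<lambda>i. inv g (q i))" for g :: "'a \<Rightarrow> 'a"
  define E where "E = \<Psi> ` G"
  have inj: "inj_on \<Psi> G"
  proof (rule inj_onI, rule ext)
    fix g h x assume gh: "g \<in> G" "h \<in> G" "\<Psi> g = \<Psi> h"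
    have "dist (g x) (h x) < e" if e: "e > 0" for e
    proof -
      obtain i where i: "dist (q i) x < e / 2" using q[of "e/2" x] e by auto
      have "g (q i) = h (q i)" using arg_cong[OF gh(3), of "\<lambda>p. fst p i"] by (simp add: \<Psi>_def)
      then have "dist (g x) (h x) \<le> dist (g (q i)) (g x) + dist (h (q i)) (h x)"
        using dist_triangle3[of "g x" "h x" "g (q i)"] by metis
      then show ?thesis using i gh by simp
    qed
    then show "g x = h x" using zero_less_dist_iff by blast
  qed
  have cont: "continuous_map (tau G) (top_of_set E) \<Psi>"
  proof -
    have "continuous_map (tau G) euclidean (\<lambda>g. \<lambda>i. g (q i))"
      "continuous_map (tau G) euclidean (\<lambda>g. \<lambda>i. inv g (q i))"
      unfolding euclidean_product_topology[symmetric] continuous_map_componentwise_UNIV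
      using continuous_map_eval continuous_map_inv by (auto simp: continuous_map_tau)
    then have "continuous_map (tau G) euclidean \<Psi>"
      using continuous_map_pairedI[of "tau G" euclidean "\<lambda>g i. g (q i)" euclidean "\<lambda>g i. inv g (q i)"]
      by (simp add: \<Psi>_def[abs_def])
    then show ?thesis by (auto simp: continuous_map_in_subtopology E_def)
  qed
  have cont_coord: "continuous_on UNIV (\<lambda>w :: (nat \<Rightarrow> 'a) \<times> (nat \<Rightarrow> 'a). fst w i)"
    "continuous_on UNIV (\<lambda>w :: (nat \<Rightarrow> 'a) \<times> (nat \<Rightarrow> 'a). snd w i)" for i
    by (rule continuous_on_compose2[where g = "\<lambda>x. x i" and t = UNIV];
        simp add: continuous_on_fst continuous_on_snd)+
  \<comment> \<open>One coordinate suffices for a given \<open>x\<close>: if \<open>q i\<close> is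
    close to \<open>x\<close>, then the value at \<open>q i\<close> determines the value at
    \<open>x\<close> up to a small error.\<close>
  have cont_inv: "continuous_map (top_of_set E) (tau G) (inv_into G \<Psi>)"
    unfolding continuous_map_tau continuous_map_euclidean_metric
  proof (intro conjI allI ballI impI)
    fix x z and e :: real assume z: "z \<in> topspace (top_of_set E)" and "e > 0"
    then obtain g where g: "g \<in> G" "z = \<Psi> g" by (auto simp: E_def)
    obtain i where i: "dist (q i) x < e / 4" using q[of "e/4" x] \<open>e > 0\<close> by auto
    let ?U = "{w \<in> topspace (top_of_set E). dist (fst z i) (fst w i) < e / 4}"
    have "openin (top_of_set E) ?U"
      using continuous_on_subset[OF cont_coord(1)] by (intro openin_dist_less) auto
    moreover have "z \<in> ?U" using z \<open>e > 0\<close> by simp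
    moreover have "dist (inv_into G \<Psi> z x) (inv_into G \<Psi> w x) < e" if w: "w \<in> ?U" for w
    proof -
      obtain h where h: "h \<in> G" "w = \<Psi> h" using w by (auto simp: E_def)
      have "dist (g (q i)) (h (q i)) < e / 4" using w g h by (simp add: \<Psi>_def)
      moreover have "dist (g x) (h x) \<le> dist (g (q i)) (g x) + dist (g (q i)) (h (q i)) + dist (h (q i)) (h x)"
        using dist_triangle3[of "g x" "h x" "g (q i)"] dist_triangle[of "g (q i)" "h x" "h (q i)"] by linarith
      ultimately have "dist (g x) (h x) < e" using i g h \<open>e > 0\<close> by simp
      then show ?thesis using g h inj by simp
    qed
    ultimately show "\<exists>U. openin (top_of_set E) U \<and> z \<in> U \<and>
        (\<forall>w\<in>U. dist (inv_into G \<Psi> z x) (inv_into G \<Psi> w x) < e)" by blast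
  qed (auto simp: E_def inv_into_into)
  have "homeomorphic_maps (tau G) (top_of_set E) \<Psi> (inv_into G \<Psi>)"
    using cont cont_inv inj by (auto simp: homeomorphic_maps_def E_def)
  then have hom: "tau G homeomorphic_space top_of_set E" unfolding homeomorphic_space_def by blast
  have "closed E"
    unfolding closed_sequential_limits
  proof (intro allI impI, elim conjE)
    fix X l assume XE: "\<forall>n. X n \<in> E" and lim: "X \<longlonglongrightarrow> l"
    then have "\<forall>n. \<exists>g. g \<in> G \<and> X n = \<Psi> g" by (auto simp: E_def)
    then obtain g where g: "\<And>n. g n \<in> G" "\<And>n. X n = \<Psi> (g n)" by metis
    have coord: "(\<lambda>n. fst (X n) i) \<longlonglongrightarrow> fst l i" "(\<lambda>n. snd (X n) i) \<longlonglongrightarrow> snd l i" for i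
    proof -
      show "(\<lambda>n. fst (X n) i) \<longlonglongrightarrow> fst l i" "(\<lambda>n. snd (X n) i) \<longlonglongrightarrow> snd l i"
        using continuous_on_tendsto_compose[OF cont_coord(1) lim] continuous_on_tendsto_compose[OF cont_coord(2) lim]
        by simp_all
    qed
    \<comment> \<open>Convergence on the dense sequence spreads to all points: equicontinuity gives
      Cauchy sequences, and the space is complete.\<close>
    have extend: "\<exists>L. (\<forall>x. (\<lambda>n. k n x) \<longlonglongrightarrow> L x)"
      if k: "\<And>n. k n \<in> G" and c: "\<And>i. (\<lambda>n. k n (q i)) \<longlonglongrightarrow> b i" for k b
    proof -
      have "Cauchy (\<lambda>n. k n x)" for x
      proof (rule metric_CauchyI)
        fix e :: real assume "e > 0"
        then obtain i where i: "dist (q i) x < e / 4" using q[of "e/4" x] by auto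
        have "Cauchy (\<lambda>n. k n (q i))" using c by (rule LIMSEQ_imp_Cauchy)
        then obtain N where N: "\<And>m n. m \<ge> N \<Longrightarrow> n \<ge> N \<Longrightarrow> dist (k m (q i)) (k n (q i)) < e / 4"
          using \<open>e > 0\<close> unfolding Cauchy_def by (meson divide_pos_pos zero_less_numeral)
        have "dist (k m x) (k n x) < e" if "m \<ge> N" "n \<ge> N" for m n
        proof -
          have "dist (k m x) (k n x) \<le> dist (k m (q i)) (k m x) + dist (k m (q i)) (k n (q i)) + dist (k n (q i)) (k n x)"
            using dist_triangle3[of "k m x" "k n x" "k m (q i)"]
              dist_triangle[of "k m (q i)" "k n x" "k n (q i)"] by linarith
          then show ?thesis using i N[OF that] k \<open>e > 0\<close> by simp
        qed
        then show "\<exists>M. \<forall>m\<ge>M. \<forall>n\<ge>M. dist (k m x) (k n x) < e" by blast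
      qed
      then have "\<forall>x. \<exists>l. (\<lambda>n. k n x) \<longlonglongrightarrow> l"
        by (simp add: Cauchy_convergent_iff convergent_def)
      then show ?thesis by (rule choice)
    qed
    have "(\<lambda>n. g n (q i)) \<longlonglongrightarrow> fst l i" "(\<lambda>n. inv (g n) (q i)) \<longlonglongrightarrow> snd l i" for i
      using coord[of i] by (simp_all add: g(2) \<Psi>_def)
    note lim_q = this
    obtain a where a: "\<And>x. (\<lambda>n. g n x) \<longlonglongrightarrow> a x"
      using extend[of g, OF g(1) lim_q(1)] by blast
    obtain b where b: "\<And>x. (\<lambda>n. inv (g n) x) \<longlonglongrightarrow> b x"
      using extend[of "\<lambda>n. inv (g n)", OF inv_in[OF g(1)] lim_q(2)] by blast
    have ab: "a (b x) = x" for x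
    proof -
      have "(\<lambda>n. dist (inv (g n) x) (b x)) \<longlonglongrightarrow> dist (b x) (b x)"
        by (intro tendsto_intros b)
      moreover have "dist (inv (g n) x) (b x) = dist x (g n (b x))" for n
        using g(1)[of n] by (metis dist_eq f_inv_eq)
      ultimately have "(\<lambda>n. dist x (g n (b x))) \<longlonglongrightarrow> 0" by simp
      moreover have "(\<lambda>n. dist x (g n (b x))) \<longlonglongrightarrow> dist x (a (b x))"
        by (intro tendsto_intros a)
      ultimately show ?thesis using LIMSEQ_unique by fastforce
    qed
    have a_iso: "dist (a x) (a y) = dist x y" for x y
    proof -
      have "(\<lambda>n. dist (g n x) (g n y)) \<longlonglongrightarrow> dist (a x) (a y)" by (intro tendsto_intros a)
      then show ?thesis using g by (simp add: LIMSEQ_const_iff)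
    qed
    \<comment> \<open>\<open>G\<close> is closed only relative to \<open>Iso\<close>, so the limit
      has to be recognised as a surjective isometry before closedness applies.\<close>
    have "a \<in> Iso" using a_iso ab unfolding Iso_def isometry_def by (auto simp: surj_def) (metis)
    moreover have "limitin pointwise_top g a sequentially"
      unfolding pointwise_top_def limitin_componentwise using a by auto
    ultimately have "limitin (subtopology pointwise_top Iso) g a sequentially"
      using g isometry by (auto simp: limitin_subtopology Iso_def)
    then have "a \<in> G"
      using closed_subgroup g(1) unfolding closed_subgroup_Iso_def
      by (intro limitin_closedin[where F = sequentially and S = G]) auto
    have "inv a = b" using \<open>a \<in> G\<close> ab by (metis ext inv_f_eq)
    have "fst l i = a (q i)" for i
      using lim_q(1) a by (rule LIMSEQ_unique)
    moreover have "snd l i = inv a (q i)" for i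
      unfolding \<open>inv a = b\<close> using lim_q(2) b by (rule LIMSEQ_unique)
    ultimately have "l = \<Psi> a" unfolding \<Psi>_def by (auto simp: prod_eq_iff)
    then show "l \<in> E" using \<open>a \<in> G\<close> by (simp add: E_def)
  qed
  then have "completely_metrizable_space (top_of_set E)"
    by (intro completely_metrizable_space_closedin completely_metrizable_space_euclidean) auto
  then show "completely_metrizable_space (tau G)"
    using hom homeomorphic_completely_metrizable_space by blast
  have "second_countable (top_of_set E)" by (intro second_countable_subtopology) simp
  then show "second_countable (tau G)" using hom homeomorphic_space_second_countability by blast
qed

section \<open>Generic tuples\<close>

lemma tau_pow_eq: "tau_pow G n = power_top (tau G) n"
  by (simp add: tau_pow_def)

lemma nbhd_pow_conj_orbitD:
  assumes "x \<in> nbhd_pow G n (conj_orbit G n g) \<epsilon>"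
  shows "\<exists>k\<in>G. \<forall>i<n. near \<epsilon> (x i) (conjugate k (g i))"
proof -
  obtain a where a: "a \<in> conj_orbit G n g" "\<forall>i<n. unif_dist (x i) (a i) < ereal \<epsilon>"
    using assms unfolding nbhd_pow_def by blast
  then obtain k where k: "k \<in> G" "a = (\<lambda>i\<in>{..<n}. k \<circ> g i \<circ> inv k)"
    unfolding conj_orbit_def by blast
  then have "\<forall>i<n. near \<epsilon> (x i) (conjugate k (g i))"
    using a(2) unif_dist_less_imp_near by (fastforce simp: conjugate_def)
  then show ?thesis using k(1) by blast
qed

text \<open>Ample generics only provide an orbit depending on \<open>\<epsilon>\<close>; intersecting the neighbourhoods of
  these orbits gives a comeagre set in which any two tuples have orbits at distance zero.\<close>

lemma generic_tuples:
  assumes "ample_generics G"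
  obtains \<Omega> where "\<And>n. comeagre_in (power_top (tau G) n) (\<Omega> n)"
    "\<And>n x y \<epsilon>. x \<in> \<Omega> n \<Longrightarrow> y \<in> \<Omega> n \<Longrightarrow> \<epsilon> > 0 \<Longrightarrow> \<exists>k\<in>G. \<forall>i<n. near \<epsilon> (conjugate k (x i)) (y i)"
proof -
  have "\<exists>g. comeagre_in (tau_pow G n) (nbhd_pow G n (conj_orbit G n g) (1 / real (Suc m)))" for n m
    using assms unfolding ample_generics_def by (metis of_nat_0_less_iff zero_less_Suc zero_less_divide_1_iff)
  then obtain g where g: "\<And>n m. comeagre_in (power_top (tau G) n)
      (nbhd_pow G n (conj_orbit G n (g n m)) (1 / real (Suc m)))"
    unfolding tau_pow_eq by metis
  let ?N = "\<lambda>n m. nbhd_pow G n (conj_orbit G n (g n m)) (1 / real (Suc m))"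
  show thesis
  proof
    fix n
    show "comeagre_in (power_top (tau G) n) (topspace (power_top (tau G) n) \<inter> (\<Inter>m\<in>UNIV. ?N n m))"
      using g by (intro comeagre_in_countable_INT) auto
    fix x y and \<epsilon> :: real
    assume x: "x \<in> topspace (power_top (tau G) n) \<inter> (\<Inter>m\<in>UNIV. ?N n m)"
      and y: "y \<in> topspace (power_top (tau G) n) \<inter> (\<Inter>m\<in>UNIV. ?N n m)" and "\<epsilon> > 0"
    \<comment> \<open>Both tuples are this close to the orbit of the same \<open>g n m\<close>.
      Going from \<open>x\<close> to that orbit and on to \<open>y\<close> by
      \<open>l \<circ> inv k\<close> makes the error twice, hence the half.\<close>
    obtain m where m: "1 / real (Suc m) < \<epsilon> / 2"
      using \<open>\<epsilon> > 0\<close> by (metis half_gt_zero nat_approx_posE)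
    obtain k where k: "k \<in> G" "\<And>i. i < n \<Longrightarrow> near (1 / real (Suc m)) (x i) (conjugate k (g n m i))"
      using nbhd_pow_conj_orbitD[of x n "g n m" "1 / real (Suc m)"] x by blast
    obtain l where l: "l \<in> G" "\<And>i. i < n \<Longrightarrow> near (1 / real (Suc m)) (y i) (conjugate l (g n m i))"
      using nbhd_pow_conj_orbitD[of y n "g n m" "1 / real (Suc m)"] y by blast
    have "near \<epsilon> (conjugate (l \<circ> inv k) (x i)) (y i)" if i: "i < n" for i
    proof -
      have "near (1 / real (Suc m)) (conjugate (l \<circ> inv k) (x i)) (conjugate (l \<circ> inv k) (conjugate k (g n m i)))"
        using k l i by (simp add: near_conjugate)
      moreover have "conjugate (l \<circ> inv k) (conjugate k (g n m i)) = conjugate l (g n m i)"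
        using k(1) l(1) by (simp add: conjugate_comp)
      ultimately show ?thesis
        using near_trans[OF _ near_sym[OF l(2)[OF i]], THEN near_mono] m by (metis field_sum_of_halves add_mono less_imp_le)
    qed
    then show "\<exists>k\<in>G. \<forall>i<n. near \<epsilon> (conjugate k (x i)) (y i)"
      using k(1) l(1) by (intro bexI[of _ "l \<circ> inv k"]) auto
  qed
qed

lemma nonmeagre_tau: "\<not> meagre_in (tau G) G"
  using completely_metrizable_nonmeagre_open[OF completely_metrizable_tau, of G]
    openin_topspace[of "tau G"] id_in by (metis empty_iff topspace_tau)

lemma comeagre_imp_nonmeagre: "comeagre_in (tau G) Y \<Longrightarrow> \<not> meagre_in (tau G) Y"
  using nonmeagre_in_Int_comeagre_in[OF nonmeagre_tau, of Y] by (simp add: comeagre_in_def Int_absorb1)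

section \<open>Local orbits under small conjugators\<close>

text \<open>The orbit of \<open>g\<close> under the small elements that nearly commute with the
  tuple, thickened by \<open>\<epsilon>\<close>. The factor 2 arises because such elements are
  obtained as quotients of two conjugators, each of which fixes the tuple up to
  \<open>\<epsilon>\<close>.\<close>

definition local_orbit ::
    "(nat \<Rightarrow> 'a \<Rightarrow> 'a) \<Rightarrow> nat \<Rightarrow> 'a set \<Rightarrow> real \<Rightarrow> real \<Rightarrow> ('a \<Rightarrow> 'a) \<Rightarrow> ('a \<Rightarrow> 'a) set" where
  "local_orbit x n Q \<delta> \<epsilon> g = {y \<in> G. \<exists>v\<in>basic_nbhd Q \<delta>.
     (\<forall>i<n. near (2 * \<epsilon>) (conjugate v (x i)) (x i)) \<and> near \<epsilon> (conjugate v g) y}"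

text \<open>Conjugators are sorted by approximate values on \<open>Q\<close>, taken from a countable
  dense set; as \<open>Q\<close> is finite there are countably many classes. Two conjugators of one
  class have a quotient in \<open>basic_nbhd Q \<delta>\<close>, so the corresponding part of
  \<open>Y\<close> lies in a conjugate of the local orbit. Were the local orbit meagre,
  \<open>Y\<close> would be meagre too.\<close>

lemma nonmeagre_local_orbit:
  assumes Y: "comeagre_in (tau G) Y"
    and orb: "\<And>y. y \<in> Y \<Longrightarrow> \<exists>k\<in>G. (\<forall>i<n. near \<epsilon> (conjugate k (x i)) (x i)) \<and> near \<epsilon> (conjugate k g) y"
    and Q: "finite Q" "\<delta> > 0"
  shows "\<not> meagre_in (tau G) (local_orbit x n Q \<delta> \<epsilon> g)"
proof
  assume meagre: "meagre_in (tau G) (local_orbit x n Q \<delta> \<epsilon> g)"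
  obtain k where k: "\<And>y. y \<in> Y \<Longrightarrow> k y \<in> G"
    "\<And>y i. y \<in> Y \<Longrightarrow> i < n \<Longrightarrow> near \<epsilon> (conjugate (k y) (x i)) (x i)"
    "\<And>y. y \<in> Y \<Longrightarrow> near \<epsilon> (conjugate (k y) g) y"
    using orb by metis
  have YG: "Y \<subseteq> G" using Y by (simp add: comeagre_in_def)
  obtain D :: "'a set" where D: "countable D" "\<And>X. open X \<Longrightarrow> X \<noteq> {} \<Longrightarrow> \<exists>d\<in>D. d \<in> X"
    by (metis countable_dense_setE)
  let ?Y = "\<lambda>c. {y \<in> Y. \<forall>q\<in>Q. dist (k y q) (c q) < \<delta> / 2}"
  have "meagre_in (tau G) (?Y c)" for c
  proof (cases "?Y c = {}")
    case False
    then obtain y0 where y0: "y0 \<in> ?Y c" by blast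
    then have k0: "k y0 \<in> G" using k by blast
    have "?Y c \<subseteq> conjugate (k y0) ` local_orbit x n Q \<delta> \<epsilon> g"
    proof
      fix y assume y: "y \<in> ?Y c"
      let ?v = "inv (k y0) \<circ> k y"
      have ky: "k y \<in> G" using y k by blast
      have "conjugate (inv (k y0)) y \<in> local_orbit x n Q \<delta> \<epsilon> g"
        unfolding local_orbit_def
      proof (intro CollectI conjI bexI allI impI)
        show "conjugate (inv (k y0)) y \<in> G" using y YG k0 by auto
        show "?v \<in> basic_nbhd Q \<delta>"
          unfolding basic_nbhd_def
        proof (intro CollectI conjI ballI)
          fix q assume q: "q \<in> Q"
          have "dist (?v q) q = dist (k y0 (?v q)) (k y0 q)" by (rule dist_eq[OF k0, symmetric])
          also have "\<dots> = dist (k y q) (k y0 q)" using k0 by simp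
          also have "\<dots> \<le> dist (k y q) (c q) + dist (k y0 q) (c q)" by (rule dist_triangle2)
          also have "\<dots> \<le> \<delta> / 2 + \<delta> / 2" using y y0 q by (intro add_mono) (auto intro: less_imp_le)
          finally show "dist (?v q) q \<le> \<delta>" by simp
        qed (use ky k0 in simp)
        show "near (2 * \<epsilon>) (conjugate ?v (x i)) (x i)" if i: "i < n" for i
        proof -
          have "near \<epsilon> (conjugate ?v (x i)) (conjugate (inv (k y0)) (x i))"
            using k(2)[of y i] y i ky k0 by (simp add: conjugate_comp near_conjugate)
          moreover have "near \<epsilon> (conjugate (inv (k y0)) (x i)) (conjugate (inv (k y0)) (conjugate (k y0) (x i)))"
            using near_sym[OF k(2)[of y0 i]] y0 i k0 by (simp only: near_conjugate inv_in) simp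
          then have "near \<epsilon> (conjugate (inv (k y0)) (x i)) (x i)" using k0 by simp
          ultimately have "near (\<epsilon> + \<epsilon>) (conjugate ?v (x i)) (x i)" by (rule near_trans)
          then show ?thesis by simp
        qed
        show "near \<epsilon> (conjugate ?v g) (conjugate (inv (k y0)) y)"
          using k(3)[of y] y ky k0 by (simp add: conjugate_comp near_conjugate)
      qed
      then show "y \<in> conjugate (k y0) ` local_orbit x n Q \<delta> \<epsilon> g"
        using k0 by (metis conjugate_conjugate_inv image_eqI)
    qed
    moreover have "meagre_in (tau G) (conjugate (k y0) ` local_orbit x n Q \<delta> \<epsilon> g)"
      using meagre by (intro meagre_in_homeomorphic_image[OF homeomorphic_map_conjugate[OF k0]])
        (auto simp: local_orbit_def)
    ultimately show ?thesis by (meson meagre_in_subset)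
  qed (use meagre_in_empty in metis)
  then have "meagre_in (tau G) (\<Union>c\<in>PiE Q (\<lambda>_. D). ?Y c)"
    using Q(1) D(1) by (intro meagre_in_countable_Union countable_PiE) auto
  moreover have "Y \<subseteq> (\<Union>c\<in>PiE Q (\<lambda>_. D). ?Y c)"
  proof
    fix y assume y: "y \<in> Y"
    have "\<exists>d\<in>D. dist (k y q) d < \<delta> / 2" for q
      using D(2)[of "ball (k y q) (\<delta> / 2)"] Q(2) by auto
    then obtain c where c: "\<And>q. c q \<in> D" "\<And>q. dist (k y q) (c q) < \<delta> / 2" by metis
    then have "restrict c Q \<in> PiE Q (\<lambda>_. D)" "y \<in> ?Y (restrict c Q)" using y by auto
    then show "y \<in> (\<Union>c\<in>PiE Q (\<lambda>_. D). ?Y c)" by blast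
  qed
  ultimately show False using comeagre_imp_nonmeagre[OF Y] meagre_in_subset by blast
qed

text \<open>The local orbit is the first projection of the set \<open>P\<close> of pairs of a target
  and a witnessing conjugator. With the conjugations multiplied out, \<open>P\<close> is closed in
  the square of the group, hence Polish, and the result on continuous images of Polish spaces
  applies.\<close>

lemma local_orbit_comeagre_somewhere:
  assumes x: "\<And>i. i < n \<Longrightarrow> x i \<in> G" and g: "g \<in> G"
    and nm: "\<not> meagre_in (tau G) (local_orbit x n Q \<delta> \<epsilon> g)"
  shows "\<exists>U. openin (tau G) U \<and> U \<noteq> {} \<and> meagre_in (tau G) (U - local_orbit x n Q \<delta> \<epsilon> g)"
proof -
  let ?X = "prod_topology (tau G) (tau G)"
  have ev: "continuous_map ?X euclidean (\<lambda>p. snd p y)" for y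
    using continuous_map_snd[of "tau G" "tau G"] by (simp add: continuous_map_tau)
  have fst: "continuous_map ?X euclidean (\<lambda>p. fst p (snd p y))" for y
    using continuous_map_fst ev by (rule continuous_map_apply)
  have comp: "continuous_map ?X euclidean (\<lambda>p. h (snd p y))" if "h \<in> G" for h y
    using continuous_map_apply[of ?X "\<lambda>_. h", OF _ ev] that by simp
  let ?P1 = "{p \<in> topspace ?X. snd p \<in> basic_nbhd Q \<delta>}"
  let ?P2 = "\<lambda>i y. {p \<in> topspace ?X. dist (snd p (x i y)) (x i (snd p y)) \<le> 2 * \<epsilon>}"
  let ?P3 = "\<lambda>y. {p \<in> topspace ?X. dist (snd p (g y)) (fst p (snd p y)) \<le> \<epsilon>}"
  \<comment> \<open>Intersecting with \<open>topspace ?X\<close> takes care of n = 0, where the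
    intersection over the empty family is \<open>UNIV\<close>.\<close>
  define P where "P = ?P1 \<inter> (topspace ?X \<inter> (\<Inter>(i, y)\<in>{..<n} \<times> UNIV. ?P2 i y)) \<inter> (\<Inter>y. ?P3 y)"
  have "closedin ?X ?P1"
    using continuous_map_snd closedin_basic_nbhd by (rule closedin_continuous_map_preimage)
  moreover have "closedin ?X (topspace ?X \<inter> (\<Inter>(i, y)\<in>{..<n} \<times> UNIV. ?P2 i y))"
  proof (cases "n = 0")
    case False
    then show ?thesis
      by (intro closedin_Int closedin_topspace closedin_Inter)
        (auto intro!: closedin_dist_le ev comp x simp del: topspace_prod_topology)
  next
    case True
    then show ?thesis using closedin_topspace[of ?X] by simp
  qed
  moreover have "closedin ?X (\<Inter>y. ?P3 y)"
    by (intro closedin_Inter) (auto intro!: closedin_dist_le ev fst simp del: topspace_prod_topology)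
  ultimately have P: "closedin ?X P" unfolding P_def by (rule closedin_Int[OF closedin_Int])
  have "(y, v) \<in> P \<longleftrightarrow> y \<in> G \<and> v \<in> basic_nbhd Q \<delta> \<and> (\<forall>i<n. near (2 * \<epsilon>) (v \<circ> x i) (x i \<circ> v)) \<and>
      near \<epsilon> (v \<circ> g) (y \<circ> v)" for y v
    unfolding P_def by (auto simp: near_def basic_nbhd_def)
  then have "(y, v) \<in> P \<longleftrightarrow> y \<in> G \<and> v \<in> basic_nbhd Q \<delta> \<and> (\<forall>i<n. near (2 * \<epsilon>) (conjugate v (x i)) (x i)) \<and>
      near \<epsilon> (conjugate v g) y" for y v
    using near_conjugate_iff[of v] by (auto simp: basic_nbhd_def)
  then have "local_orbit x n Q \<delta> \<epsilon> g = {y. \<exists>v. (y, v) \<in> P}"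
    unfolding local_orbit_def Bex_def by blast
  also have "\<dots> = fst ` P" by force
  finally have S: "local_orbit x n Q \<delta> \<epsilon> g = fst ` P" .
  have top: "topspace (subtopology ?X P) = P" using closedin_subset[OF P] by auto
  have "completely_metrizable_space (subtopology ?X P)"
    using P completely_metrizable_tau
    by (intro completely_metrizable_space_closedin) (auto simp: completely_metrizable_space_prod_topology)
  moreover have "second_countable (subtopology ?X P)"
    using second_countable_tau by (intro second_countable_subtopology second_countable_prod_topology)
  moreover have "Hausdorff_space (tau G)"
    using completely_metrizable_tau completely_metrizable_imp_metrizable_space metrizable_imp_Hausdorff_space by blast
  moreover have "continuous_map (subtopology ?X P) (tau G) fst"
    by (intro continuous_map_from_subtopology continuous_map_fst)
  ultimately show ?thesis
    using nonmeagre_image_comeagre_somewhere[of "subtopology ?X P" "tau G" fst] second_countable_tau nm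
    unfolding top S by blast
qed

section \<open>Towers of generic tuples\<close>

text \<open>The form in which ample generics enters the branching construction. Comeagreness of each
  \<open>C n\<close> is replaced by a starting point and comeagre many one-step extensions, which is
  what a construction by stages can use.\<close>

definition generic_tower :: "(nat \<Rightarrow> (nat \<Rightarrow> 'a \<Rightarrow> 'a) set) \<Rightarrow> bool" where
  "generic_tower C \<longleftrightarrow>
    (\<forall>n. C n \<subseteq> PiE {..<n} (\<lambda>_. G)) \<and> C 0 \<noteq> {} \<and>
    (\<forall>n. \<forall>x\<in>C n. comeagre_in (tau G) {y \<in> G. x(n := y) \<in> C (Suc n)}) \<and>
    (\<forall>n. \<forall>x\<in>C n. \<forall>y\<in>C n. \<forall>\<epsilon>>0. \<exists>k\<in>G. \<forall>i<n. near \<epsilon> (conjugate k (x i)) (y i))"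

lemma ex_generic_tower:
  assumes "ample_generics G"
  shows "\<exists>C. generic_tower C"
proof -
  obtain \<Omega> where \<Omega>: "\<And>n. comeagre_in (power_top (tau G) n) (\<Omega> n)"
    "\<And>n x y \<epsilon>. x \<in> \<Omega> n \<Longrightarrow> y \<in> \<Omega> n \<Longrightarrow> \<epsilon> > 0 \<Longrightarrow> \<exists>k\<in>G. \<forall>i<n. near \<epsilon> (conjugate k (x i)) (y i)"
    using generic_tuples[OF assms] by metis
  obtain C where "\<forall>n. C n \<subseteq> \<Omega> n \<and> comeagre_in (power_top (tau G) n) (C n) \<and>
      (\<forall>x\<in>C n. comeagre_in (tau G) {y \<in> topspace (tau G). x(n := y) \<in> C (Suc n)})"
    using comeagre_in_hereditary[OF second_countable_tau \<Omega>(1)] by blast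
  then have C: "\<And>n. C n \<subseteq> \<Omega> n" "\<And>n. comeagre_in (power_top (tau G) n) (C n)"
    "\<And>n x. x \<in> C n \<Longrightarrow> comeagre_in (tau G) {y \<in> topspace (tau G). x(n := y) \<in> C (Suc n)}"
    by blast+
  \<comment> \<open>The power with exponent 0 is a one-point space, and in it no set containing that
    point is nowhere dense.\<close>
  have "C 0 \<noteq> {}"
  proof
    assume "C 0 = {}"
    then have "meagre_in (power_top (tau G) 0) (topspace (power_top (tau G) 0))"
      using C(2)[of 0] by (simp add: comeagre_in_def)
    then obtain F where "\<And>N. N \<in> F \<Longrightarrow> nowhere_dense_in (power_top (tau G) 0) N" "{\<lambda>_. undefined} \<subseteq> \<Union>F"
      unfolding meagre_in_def by auto
    then obtain N where N: "nowhere_dense_in (power_top (tau G) 0) N" "(\<lambda>_. undefined) \<in> N" by blast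
    have "topspace (power_top (tau G) 0) \<subseteq> power_top (tau G) 0 closure_of N"
      using N(2) closure_of_subset_Int[of "power_top (tau G) 0" N] by auto
    then have "power_top (tau G) 0 interior_of (power_top (tau G) 0 closure_of N) = topspace (power_top (tau G) 0)"
      by (metis closure_of_subset_topspace interior_of_topspace subset_antisym)
    then show False using N(1) unfolding nowhere_dense_in_def by simp
  qed
  moreover have "C n \<subseteq> PiE {..<n} (\<lambda>_. G)" for n
    using C(2)[of n] by (simp add: comeagre_in_def)
  ultimately have "generic_tower C"
    using \<Omega>(2)[OF subsetD[OF C(1)] subsetD[OF C(1)]] C(3)
    by (simp add: generic_tower_def)
  then show ?thesis by blast
qed

lemma generic_tower_in:
  assumes "generic_tower C" "x \<in> C n" "i < n"
  shows "x i \<in> G"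
proof -
  have "C n \<subseteq> PiE {..<n} (\<lambda>_. G)" using assms(1) unfolding generic_tower_def by blast
  then show ?thesis using assms(2,3) by (auto simp: PiE_iff)
qed

lemma generic_tower_conjugate:
  assumes "generic_tower C" "x \<in> C n" "y \<in> C n" "\<epsilon> > 0"
  shows "\<exists>k\<in>G. \<forall>i<n. near \<epsilon> (conjugate k (x i)) (y i)"
proof -
  have "\<forall>n. \<forall>x\<in>C n. \<forall>y\<in>C n. \<forall>\<epsilon>>0. \<exists>k\<in>G. \<forall>i<n. near \<epsilon> (conjugate k (x i)) (y i)"
    using assms(1) unfolding generic_tower_def by (elim conjE)
  from this[rule_format, OF assms(2-4)] show ?thesis .
qed

text \<open>The hypotheses on \<open>A\<close> and \<open>B\<close> differ because of the order of
  choice. First g0 is picked, for which \<open>A\<close> only has to meet a comeagre set. The local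
  orbit of g0 is then comeagre in an open set that cannot be chosen, and \<open>B\<close> has to be
  non-meagre there.\<close>

lemma generic_tower_split:
  assumes C: "generic_tower C" and x: "x \<in> C n"
    and A: "\<not> meagre_in (tau G) A" "A \<subseteq> G"
    and B: "\<And>U. openin (tau G) U \<Longrightarrow> U \<noteq> {} \<Longrightarrow> \<not> meagre_in (tau G) (B \<inter> U)"
    and V: "openin (tau G) V" "id \<in> V" and "\<epsilon> > 0"
  shows "\<exists>g0\<in>A. \<exists>g1\<in>B. \<exists>v\<in>V. x(n := g0) \<in> C (Suc n) \<and> x(n := g1) \<in> C (Suc n) \<and>
    (\<forall>i<n. near \<epsilon> (conjugate v (x i)) (x i)) \<and> near \<epsilon> (conjugate v g0) g1"
proof -
  let ?Y = "{y \<in> G. x(n := y) \<in> C (Suc n)}"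
  have Y: "comeagre_in (tau G) ?Y" using C x unfolding generic_tower_def by blast
  have xG: "x i \<in> G" if "i < n" for i using generic_tower_in[OF C x that] .
  obtain Q \<delta> where Q: "finite Q" "\<delta> > 0" "basic_nbhd Q \<delta> \<subseteq> V"
    using basic_nbhd_subset_open[OF V] .
  have "A \<inter> ?Y \<noteq> {}"
    using nonmeagre_in_Int_comeagre_in[OF A(1) _ Y] A(2) by (metis meagre_in_empty topspace_tau)
  then obtain g0 where g0: "g0 \<in> A" "g0 \<in> ?Y" by blast
  let ?S = "local_orbit x n Q \<delta> (\<epsilon>/2) g0"
  \<comment> \<open>Both \<open>x(n := g0)\<close> and \<open>x(n := y)\<close> are generic tuples
    of length n + 1, so one conjugator serves the old entries and the new one. Half of
    \<open>\<epsilon>\<close> compensates the factor 2 in \<open>local_orbit\<close>.\<close>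
  have "\<exists>k\<in>G. (\<forall>i<n. near (\<epsilon>/2) (conjugate k (x i)) (x i)) \<and> near (\<epsilon>/2) (conjugate k g0) y" if y: "y \<in> ?Y" for y
  proof -
    obtain k where k: "k \<in> G" "\<forall>i<Suc n. near (\<epsilon>/2) (conjugate k ((x(n := g0)) i)) ((x(n := y)) i)"
      using generic_tower_conjugate[OF C, of "x(n := g0)" "Suc n" "x(n := y)" "\<epsilon>/2"] g0(2) y \<open>\<epsilon> > 0\<close>
      by auto
    have "near (\<epsilon>/2) (conjugate k (x i)) (x i)" if "i < n" for i using k(2)[rule_format, of i] that by simp
    moreover have "near (\<epsilon>/2) (conjugate k g0) y" using k(2)[rule_format, of n] by simp
    ultimately show ?thesis using k(1) by blast
  qed
  then have "\<not> meagre_in (tau G) ?S" using Y Q(1,2) by (intro nonmeagre_local_orbit)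
  then obtain U where U: "openin (tau G) U" "U \<noteq> {}" "meagre_in (tau G) (U - ?S)"
    using local_orbit_comeagre_somewhere[of n x g0 Q \<delta> "\<epsilon>/2"] xG g0(2) by blast
  have "U \<subseteq> G" using openin_subset[OF U(1)] by simp
  then have "\<not> meagre_in (tau G) (B \<inter> U \<inter> ?Y)"
    using nonmeagre_in_Int_comeagre_in[OF B[OF U(1,2)] _ Y] by auto
  then have "\<not> B \<inter> U \<inter> ?Y \<subseteq> U - ?S" using U(3) meagre_in_subset by blast
  then obtain g1 where g1: "g1 \<in> B" "g1 \<in> ?Y" "g1 \<in> ?S" by blast
  then obtain v where v: "v \<in> basic_nbhd Q \<delta>" "\<forall>i<n. near (2 * (\<epsilon>/2)) (conjugate v (x i)) (x i)"
    "near (\<epsilon>/2) (conjugate v g0) g1" unfolding local_orbit_def by blast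
  show ?thesis
  proof (intro bexI conjI allI impI)
    show "near \<epsilon> (conjugate v (x i)) (x i)" if "i < n" for i using v(2) that by simp
    show "near \<epsilon> (conjugate v g0) g1" using v(3) by (rule near_mono) (use \<open>\<epsilon> > 0\<close> in simp)
  qed (use g0 g1 v(1) Q(3) in auto)
qed

section \<open>The Bergman property\<close>

lemma set_power_subset: "S \<subseteq> G \<Longrightarrow> set_power S k \<subseteq> G"
proof (induction k)
  case (Suc k)
  then show ?case by (auto simp del: o_apply intro!: comp_in)
qed simp

lemma inv_in_set_power:
  assumes "S \<subseteq> G" "\<And>s. s \<in> S \<Longrightarrow> inv s \<in> S"
  shows "s \<in> set_power S k \<Longrightarrow> inv s \<in> set_power S k"
proof (induction k arbitrary: s)
  case (Suc k)
  then obtain a b where ab: "s = a \<circ> b" "a \<in> S" "b \<in> set_power S k" by auto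
  have "inv s = inv b \<circ> inv a"
    unfolding ab(1) using ab(2,3) assms(1) set_power_subset[OF assms(1)] by (intro inv_comp) auto
  \<comment> \<open>\<open>set_power\<close> splits off factors on the left, whereas inversion moves
    this factor to the right end; hence the detour through addition of exponents.\<close>
  moreover have "inv b \<circ> inv a \<in> set_power S (k + Suc 0)"
    using ab Suc.IH assms(2) by (intro set_power_comp set_power_Suc_0) auto
  ultimately show ?case by (simp only: add_Suc_right add_0_right)
qed simp

lemma nbhd_subset: "nbhd G W \<epsilon> \<subseteq> G"
  by (auto simp: nbhd_def)

lemma near_imp_in_nbhd: "g \<in> G \<Longrightarrow> w \<in> W \<Longrightarrow> near r g w \<Longrightarrow> r < \<epsilon> \<Longrightarrow> g \<in> nbhd G W \<epsilon>"
  unfolding nbhd_def using near_imp_unif_dist_less by blast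

lemma subset_nbhd: "W \<subseteq> G \<Longrightarrow> \<epsilon> > 0 \<Longrightarrow> W \<subseteq> nbhd G W \<epsilon>"
  using near_imp_in_nbhd near_refl by blast

lemma nbhd_mono: "V \<subseteq> W \<Longrightarrow> nbhd G V \<epsilon> \<subseteq> nbhd G W \<epsilon>"
  by (auto simp: nbhd_def)

text \<open>Inversion does not increase the uniform distance: at \<open>x\<close> the inverses
  differ by exactly as much as \<open>g\<close> and \<open>w\<close> differ at
  \<open>inv w x\<close>.\<close>

lemma inv_in_nbhd:
  assumes W: "W \<subseteq> G" "\<And>w. w \<in> W \<Longrightarrow> inv w \<in> W" and g: "g \<in> nbhd G W \<epsilon>"
  shows "inv g \<in> nbhd G W \<epsilon>"
proof -
  obtain w where w: "g \<in> G" "w \<in> W" "unif_dist g w < ereal \<epsilon>" using g by (auto simp: nbhd_def)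
  have wG: "w \<in> G" using w W by blast
  have eq: "dist (inv g x) (inv w x) = dist (g (inv w x)) (w (inv w x))" for x
  proof -
    have "dist (inv g x) (inv w x) = dist (g (inv g x)) (g (inv w x))" using w(1) by (rule dist_eq[symmetric])
    then show ?thesis using w(1) wG by (simp add: dist_commute)
  qed
  have "unif_dist (inv g) (inv w) \<le> unif_dist g w"
    unfolding unif_dist_def
  proof (rule SUP_least)
    fix x
    show "ereal (dist (inv g x) (inv w x)) \<le> (SUP x. ereal (dist (g x) (w x)))"
      unfolding eq by (rule SUP_upper[of _ UNIV "\<lambda>x. ereal (dist (g x) (w x))"]) simp
  qed
  then show ?thesis using w W by (auto simp: nbhd_def intro: le_less_trans)
qed

section \<open>Identity neighbourhoods and double cosets\<close>

text \<open>For \<open>v\<close> near the identity, \<open>U\<close> and its left translate by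
  \<open>v\<close> overlap in a non-empty open set. Both \<open>S\<close> and its translate are
  comeagre there, so they meet, and a common point is some s = v t with s and t in
  \<open>S\<close>.\<close>

lemma Pettis:
  assumes U: "openin (tau G) U" "U \<noteq> {}" and S: "meagre_in (tau G) (U - S)"
  shows "\<exists>V. openin (tau G) V \<and> id \<in> V \<and> (\<forall>v\<in>V. \<exists>s\<in>S. \<exists>t\<in>S. v = s \<circ> inv t)"
proof -
  obtain u where u: "u \<in> U" using U(2) by blast
  have UG: "U \<subseteq> G" using openin_subset[OF U(1)] by simp
  let ?V = "{v \<in> topspace (tau G). v \<circ> u \<in> U}"
  have "continuous_map (tau G) (tau G) (\<lambda>v. v \<circ> u)"
    using continuous_map_mult[of "tau G" "\<lambda>v. v" "\<lambda>_. u"] u UG by auto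
  then have "openin (tau G) ?V" using U(1) by (rule openin_continuous_map_preimage)
  moreover have "id \<in> ?V" using u by simp
  moreover have "\<exists>s\<in>S. \<exists>t\<in>S. v = s \<circ> inv t" if v: "v \<in> ?V" for v
  proof -
    have vG: "v \<in> G" using v by simp
    note hom = homeomorphic_map_mult_left[OF vG]
    let ?U = "U \<inter> (\<lambda>g. v \<circ> g) ` U"
    have "openin (tau G) ((\<lambda>g. v \<circ> g) ` U)"
      using hom U(1) UG by (metis homeomorphic_map_openness_eq)
    then have "openin (tau G) ?U" using U(1) by blast
    moreover have "v \<circ> u \<in> ?U" using v u by blast
    ultimately have "\<not> meagre_in (tau G) ?U"
      using completely_metrizable_nonmeagre_open[OF completely_metrizable_tau] by blast
    moreover have "meagre_in (tau G) ((U - S) \<union> (\<lambda>g. v \<circ> g) ` (U - S))"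
      using UG by (intro meagre_in_Un S meagre_in_homeomorphic_image[OF hom]) auto
    ultimately have "\<not> ?U \<subseteq> (U - S) \<union> (\<lambda>g. v \<circ> g) ` (U - S)"
      using meagre_in_subset by blast
    then obtain s t where "s \<in> U" "s \<in> S" "t \<in> U" "t \<in> S" "s = v \<circ> t" by blast
    moreover from this have "v = s \<circ> inv t" using UG by (auto simp: fun_eq_iff)
    ultimately show ?thesis by blast
  qed
  ultimately show ?thesis by blast
qed

text \<open>With \<open>V = basic_nbhd Q \<delta>\<close>: the group is a union \<open>V F V\<close> of finitely many double cosets,
  because there are finitely many orbits of pairs \<open>(q, g q)\<close>, up to \<open>\<delta> / 4\<close>.\<close>

lemma approx_oligomorphic_double_cosets:
  assumes olig: "approx_oligomorphic G" and Q: "finite Q" and \<delta>: "\<delta> > 0"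
  obtains F where "finite F" "F \<subseteq> G"
    "\<And>g. g \<in> G \<Longrightarrow> \<exists>v\<in>basic_nbhd Q \<delta>. \<exists>f\<in>F. \<exists>w\<in>basic_nbhd Q \<delta>. g = v \<circ> (f \<circ> w)"
proof -
  obtain m and q :: "nat \<Rightarrow> 'a" where q: "Q = q ` {..<m}"
    using finite_imp_nat_seg_image_inj_on[OF Q] by (metis lessThan_def)
  \<comment> \<open>The tuple of length 2m lists the points of \<open>Q\<close> and then their
    images under \<open>g\<close>; it determines \<open>g\<close> up to small factors on both
    sides.\<close>
  define X where "X g i = (if i < m then q i else g (q (i - m)))" for g i
  have "\<exists>B :: (nat \<Rightarrow> 'a) set. finite B \<and>
      (\<forall>x. \<exists>b\<in>B. \<exists>k\<in>G. \<forall>i<2*m. dist (k (b i)) (x i) \<le> \<delta> / 4)"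
    using olig[unfolded approx_oligomorphic_def, rule_format, of "\<delta> / 4" "2 * m"] \<delta> by simp
  then obtain B :: "(nat \<Rightarrow> 'a) set" where B: "finite B"
    "\<And>x. \<exists>b\<in>B. \<exists>k\<in>G. \<forall>i<2*m. dist (k (b i)) (x i) \<le> \<delta> / 4" by blast
  define rel where "rel b g \<longleftrightarrow> g \<in> G \<and> (\<exists>k\<in>G. \<forall>i<2*m. dist (k (b i)) (X g i) \<le> \<delta> / 4)" for b g
  define f where "f b = (SOME g. rel b g)" for b
  have f: "rel b (f b)" if "rel b g" for b g using someI[of "rel b" g] that by (simp add: f_def)
  let ?F = "f ` {b \<in> B. \<exists>g. rel b g}"
  show thesis
  proof
    show "finite ?F" using B(1) by simp
    show "?F \<subseteq> G" using f unfolding rel_def by blast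
    fix g assume g: "g \<in> G"
    obtain b k where b: "b \<in> B" and k: "k \<in> G" "\<And>i. i < 2*m \<Longrightarrow> dist (k (b i)) (X g i) \<le> \<delta> / 4"
      using B(2)[of "X g"] by blast
    then have "rel b g" using g unfolding rel_def by blast
    then have "rel b (f b)" and fF: "f b \<in> ?F" using f b by blast+
    then obtain l where fG: "f b \<in> G" and l: "l \<in> G" "\<And>i. i < 2*m \<Longrightarrow> dist (l (b i)) (X (f b) i) \<le> \<delta> / 4"
      unfolding rel_def by blast
    \<comment> \<open>\<open>?v\<close> carries the tuple of \<open>f b\<close> to that of
      \<open>g\<close>, up to \<open>\<delta>\<close>, since \<open>k\<close> and \<open>l\<close>
      start from the same \<open>b\<close>. The first halves show that \<open>?v\<close> is small.
      The second halves say that \<open>?v \<circ> f b\<close> and \<open>g\<close> nearly agree on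
      \<open>Q\<close>, so the remaining factor \<open>?w\<close> is small.\<close>
    let ?v = "k \<circ> inv l" and ?w = "inv (f b) \<circ> (inv (k \<circ> inv l) \<circ> g)"
    have vG: "?v \<in> G" using k(1) l(1) by simp
    have v: "dist (?v (X (f b) i)) (X g i) \<le> \<delta>" if i: "i < 2*m" for i
    proof -
      have "dist (?v (X (f b) i)) (k (b i)) = dist (inv l (X (f b) i)) (inv l (l (b i)))"
        using k(1) l(1) by simp
      also have "\<dots> = dist (X (f b) i) (l (b i))" by (rule dist_eq) (use l(1) in simp)
      also have "\<dots> \<le> \<delta> / 4" using l(2)[OF i] by (simp add: dist_commute)
      finally have "dist (?v (X (f b) i)) (k (b i)) \<le> \<delta> / 4" .
      then show ?thesis
        using k(2)[OF i] dist_triangle[of "?v (X (f b) i)" "X g i" "k (b i)"] \<delta> by linarith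
    qed
    have "?v \<in> basic_nbhd Q \<delta>"
    proof -
      have "dist (?v (q i)) (q i) \<le> \<delta>" if "i < m" for i
        using v[of i] that unfolding X_def by simp
      then show ?thesis using vG unfolding basic_nbhd_def q by auto
    qed
    moreover have "?w \<in> basic_nbhd Q \<delta>"
    proof -
      have "dist (?w (q i)) (q i) \<le> \<delta>" if i: "i < m" for i
      proof -
        have "dist (?w (q i)) (q i) = dist (f b (?w (q i))) (f b (q i))" using fG by (rule dist_eq[symmetric])
        also have "\<dots> = dist (?v (f b (?w (q i)))) (?v (f b (q i)))" using vG by (rule dist_eq[symmetric])
        also have "?v (f b (?w (q i))) = g (q i)" using fG f_inv_eq[OF vG] by simp
        also have "dist (g (q i)) (?v (f b (q i))) \<le> \<delta>"
          using v[of "i + m"] i unfolding X_def by (simp add: dist_commute)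
        finally show ?thesis .
      qed
      moreover have "?w \<in> G" using fG k(1) l(1) g by (intro comp_in inv_in)
      ultimately show ?thesis unfolding basic_nbhd_def q by blast
    qed
    moreover have "g = ?v \<circ> (f b \<circ> ?w)"
    proof
      fix y show "g y = (?v \<circ> (f b \<circ> ?w)) y" using fG f_inv_eq[OF vG, of "g y"] by simp
    qed
    ultimately show "\<exists>v\<in>basic_nbhd Q \<delta>. \<exists>f\<in>?F. \<exists>w\<in>basic_nbhd Q \<delta>. g = v \<circ> (f \<circ> w)"
      using fF by blast
  qed
qed

section \<open>The branching construction\<close>

lemma ex_comeagre_somewhere_power:
  fixes W :: "nat \<Rightarrow> ('a \<Rightarrow> 'a) set"
  assumes ample: "ample_generics G" and \<epsilon>: "\<epsilon> > 0"
    and W: "(\<Union>n. W n) = G" "\<And>n g. g \<in> W n \<Longrightarrow> inv g \<in> W n" "\<And>n. \<not> meagre_in (tau G) (W n)"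
  shows "\<exists>n U. openin (tau G) U \<and> U \<noteq> {} \<and> meagre_in (tau G) (U - set_power (nbhd G (W n) \<epsilon>) 5)"
proof (rule ccontr)
  assume neg: "\<not> ?thesis"
  have WG: "W n \<subseteq> G" for n using W(1) by blast
  obtain C where C: "generic_tower C" using ex_generic_tower[OF ample] by blast
  obtain M d where "Metric_space M d" and comp: "Metric_space.mcomplete M d"
    and top: "tau G = Metric_space.mtopology M d"
    using completely_metrizable_tau unfolding completely_metrizable_space_def by blast
  interpret Metric_space M d by fact
  have M: "M = G" using topspace_tau unfolding top by simp
  \<comment> \<open>Three errors of at most \<open>\<delta>\<close> will be added: one for the limit
    of each branch and one for the conjugation of g0 to g1. Their sum has to be strictly below
    \<open>\<epsilon>\<close>.\<close>
  define \<delta> where "\<delta> = \<epsilon> / 4"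
  have \<delta>: "\<delta> > 0" "3 * \<delta> < \<epsilon>" using \<epsilon> by (auto simp: \<delta>_def)
  (* A state (x, h) of stage n consists of a generic n-tuple x and an approximation h to the final
     group element; L n collects the limits of all admissible continuations of a state. *)
  define valid where "valid n \<sigma> \<longleftrightarrow> fst \<sigma> \<in> C n \<and> snd \<sigma> \<in> G" for n and \<sigma> :: "(nat \<Rightarrow> 'a \<Rightarrow> 'a) \<times> ('a \<Rightarrow> 'a)"
  \<comment> \<open>Both bounds are summable: the one on \<open>d\<close> makes the group elements
    Cauchy, and the uniform errors on the old entries, from any stage on, add up to at most
    \<open>\<delta>\<close>.\<close>
  define R where "R n \<sigma> \<sigma>' \<longleftrightarrow> valid (Suc n) \<sigma>' \<and> d (snd \<sigma>) (snd \<sigma>') < (1/2) ^ n \<and>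
      (\<forall>i<n. fst \<sigma>' i = fst \<sigma> i \<and>
        near (\<delta> * (1/2) ^ Suc n) (conjugate (snd \<sigma>') (fst \<sigma> i)) (conjugate (snd \<sigma>) (fst \<sigma> i)))"
    for n \<sigma> \<sigma>'
  define L where "L n \<sigma> = {h. \<exists>s. s 0 = \<sigma> \<and> (\<forall>k. R (n + k) (s k) (s (Suc k))) \<and>
      limitin (tau G) (\<lambda>k. snd (s k)) h sequentially}" for n \<sigma>
  \<comment> \<open>The geometric sum of errors bounds every finite continuation. The bound survives
    the limit because, multiplied out, it is an inequality between values that converge
    pointwise.\<close>
  have L_near: "h \<in> G \<and> near \<delta> (conjugate h (fst \<sigma> i)) (conjugate (snd \<sigma>) (fst \<sigma> i))"
    if \<sigma>: "valid n \<sigma>" and h: "h \<in> L n \<sigma>" and i: "i < n" for n \<sigma> h i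
  proof -
    obtain s where s0: "s 0 = \<sigma>" and s: "\<And>k. R (n + k) (s k) (s (Suc k))"
      and lim: "limitin (tau G) (\<lambda>k. snd (s k)) h sequentially"
      using h unfolding L_def by blast
    have hG: "h \<in> G" using limitin_topspace[OF lim] by simp
    let ?g = "fst \<sigma> i" and ?c = "conjugate (snd \<sigma>) (fst \<sigma> i)"
    have cG: "?c \<in> G" using \<sigma> generic_tower_in[OF C _ i] by (simp add: valid_def)
    have sk: "snd (s k) \<in> G \<and> fst (s k) i = ?g \<and>
        near (\<delta> * ((1/2) ^ n - (1/2) ^ (n + k))) (conjugate (snd (s k)) ?g) ?c" for k
    proof (induction k)
      case 0
      then show ?case using s0 \<sigma> by (simp add: valid_def near_refl)
    next
      case (Suc k)
      have "i < n + k" using i by simp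
      then have step: "snd (s (Suc k)) \<in> G" "fst (s (Suc k)) i = fst (s k) i"
        "near (\<delta> * (1/2) ^ Suc (n + k)) (conjugate (snd (s (Suc k))) (fst (s k) i)) (conjugate (snd (s k)) (fst (s k) i))"
        using s[of k] unfolding R_def valid_def by blast+
      have IH: "fst (s k) i = ?g" "near (\<delta> * ((1/2) ^ n - (1/2) ^ (n + k))) (conjugate (snd (s k)) ?g) ?c"
        using Suc by blast+
      have "near (\<delta> * (1/2) ^ Suc (n + k) + \<delta> * ((1/2) ^ n - (1/2) ^ (n + k)))
          (conjugate (snd (s (Suc k))) ?g) ?c"
        using near_trans[OF step(3)[unfolded IH(1)] IH(2)] .
      moreover have "\<delta> * (1/2) ^ Suc (n + k) + \<delta> * ((1/2) ^ n - (1/2) ^ (n + k)) =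
          \<delta> * ((1/2) ^ n - (1/2) ^ (n + Suc k))" by (simp add: algebra_simps)
      ultimately show ?case using step(1,2) Suc by simp
    qed
    have conv: "(\<lambda>k. snd (s k) y) \<longlonglongrightarrow> h y" for y
      using continuous_map_limit[OF continuous_map_eval lim, of y] by (simp add: o_def)
    have "dist (h (?g y)) (?c (h y)) \<le> \<delta>" for y
    proof (rule LIMSEQ_le_const2)
      have "continuous_on UNIV ?c" using continuous_map_apply[of euclidean "\<lambda>_. ?c" "\<lambda>x. x"] cG by simp
      then have "(\<lambda>k. ?c (snd (s k) y)) \<longlonglongrightarrow> ?c (h y)"
        using conv by (rule continuous_on_tendsto_compose) auto
      then show "(\<lambda>k. dist (snd (s k) (?g y)) (?c (snd (s k) y))) \<longlonglongrightarrow> dist (h (?g y)) (?c (h y))"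
        by (intro tendsto_dist conv)
      have "dist (snd (s k) (?g y)) (?c (snd (s k) y)) \<le> \<delta>" for k
      proof -
        have "near (\<delta> * ((1/2) ^ n - (1/2) ^ (n + k))) (snd (s k) \<circ> ?g) (?c \<circ> snd (s k))"
          using sk[of k] near_conjugate_iff by blast
        moreover have "\<delta> * ((1/2) ^ n - (1/2) ^ (n + k)) \<le> \<delta> * 1"
        proof (intro mult_left_mono)
          have "(1/2::real) ^ n \<le> 1" "(1/2::real) ^ (n + k) \<ge> 0" by (simp_all add: power_le_one)
          then show "(1/2::real) ^ n - (1/2) ^ (n + k) \<le> 1" by linarith
        qed (use \<delta> in simp)
        ultimately have "near (\<delta> * 1) (snd (s k) \<circ> ?g) (?c \<circ> snd (s k))" by (rule near_mono)
        then show ?thesis by (simp add: near_def)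
      qed
      then show "\<exists>N. \<forall>k\<ge>N. dist (snd (s k) (?g y)) (?c (snd (s k) y)) \<le> \<delta>" by blast
    qed
    then have "near \<delta> (h \<circ> ?g) (?c \<circ> h)" by (simp add: near_def)
    then show ?thesis using near_conjugate_iff[OF hG] hG by blast
  qed
  have split: "\<exists>\<sigma>'. R n \<sigma> \<sigma>' \<and> L (Suc n) \<sigma>' \<inter> W n = {}" if \<sigma>: "valid n \<sigma>" for n \<sigma>
  proof -
    obtain x h where xh: "\<sigma> = (x, h)" by (cases \<sigma>)
    then have x: "x \<in> C n" and h: "h \<in> G" using \<sigma> by (auto simp: valid_def)
    then have hM: "h \<in> M" using M by blast
    let ?e = "\<delta> * (1/2) ^ Suc n" and ?S = "set_power (nbhd G (W n) \<epsilon>) 5"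
    have e: "?e > 0" "?e \<le> \<delta>" using \<delta> by (simp_all add: power_le_one mult_le_cancel_left1 del: power_Suc)
    \<comment> \<open>No invariance of the complete metric \<open>d\<close> is available, so how
      small \<open>v\<close> has to be depends on \<open>h\<close>.\<close>
    let ?V = "{v \<in> topspace (tau G). h \<circ> inv v \<in> mball h ((1/2) ^ n)}"
    have "continuous_map (tau G) (tau G) (\<lambda>v. h \<circ> inv v)"
      using continuous_map_mult[of "tau G" "\<lambda>_. h" inv] h continuous_map_inv by simp
    moreover have "openin (tau G) (mball h ((1/2) ^ n))" unfolding top by simp
    ultimately have V1: "openin (tau G) ?V" by (rule openin_continuous_map_preimage)
    have V2: "id \<in> ?V" using hM by simp
    have "\<not> meagre_in (tau G) ((G - ?S) \<inter> U)" if "openin (tau G) U" "U \<noteq> {}" for U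
    proof -
      have "(G - ?S) \<inter> U = U - ?S" using openin_subset[OF that(1)] by auto
      then show ?thesis using neg that by metis
    qed
    note B = this
    obtain g0 g1 v where g: "g0 \<in> W n" "g1 \<in> G - ?S" "v \<in> ?V"
      "x(n := g0) \<in> C (Suc n)" "x(n := g1) \<in> C (Suc n)"
      "\<forall>i<n. near ?e (conjugate v (x i)) (x i)" "near ?e (conjugate v g0) g1"
      using generic_tower_split[OF C x W(3)[of n] WG[of n] B V1 V2 e(1)] by blast
    have vG: "v \<in> G" and hv: "h \<circ> inv v \<in> G" using g(3) h by simp_all
    \<comment> \<open>Since conjugating \<open>conjugate v a\<close> by
      \<open>h \<circ> inv v\<close> gives \<open>conjugate h a\<close>, the inverse of
      \<open>v\<close> is the right correction: it keeps the old entries in place and aligns g1 in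
      the new branch with g0 in the old one.\<close>
    have near_hv: "near r (conjugate h a) (conjugate (h \<circ> inv v) b)" if "near r (conjugate v a) b" for r a b
    proof -
      have "near r (conjugate (h \<circ> inv v) (conjugate v a)) (conjugate (h \<circ> inv v) b)"
        using that near_conjugate[OF hv] by blast
      then show ?thesis using h vG by (simp add: conjugate_comp)
    qed
    let ?\<sigma>0 = "(x(n := g0), h)" and ?\<sigma>1 = "(x(n := g1), h \<circ> inv v)"
    have val: "valid (Suc n) ?\<sigma>0" "valid (Suc n) ?\<sigma>1"
      using g(4,5) h hv by (simp_all add: valid_def)
    have R0: "R n \<sigma> ?\<sigma>0"
      using val(1) hM e(1) unfolding R_def xh by (simp add: near_refl)
    have "near ?e (conjugate (h \<circ> inv v) (x i)) (conjugate h (x i))" if "i < n" for i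
      using near_sym[OF near_hv[OF g(6)[rule_format, OF that]]] .
    moreover have "d h (h \<circ> inv v) < (1/2) ^ n" using g(3) by simp
    ultimately have R1: "R n \<sigma> ?\<sigma>1" using val(2) unfolding R_def xh by simp
    (* Limits a, b of the two branches nearly agree on conjugating g0 to g1; if both were in W n,
       then g1 would be in W n W n (W n)_\<epsilon> W n W n, contrary to its choice. *)
    have "False" if ab: "a \<in> L (Suc n) ?\<sigma>0 \<inter> W n" "b \<in> L (Suc n) ?\<sigma>1 \<inter> W n" for a b
    proof -
      have a: "a \<in> G" "near \<delta> (conjugate a g0) (conjugate h g0)"
        using L_near[OF val(1), of a n] ab(1) by auto
      have b: "b \<in> G" "near \<delta> (conjugate b g1) (conjugate (h \<circ> inv v) g1)"
        using L_near[OF val(2), of b n] ab(2) by auto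
      have "near (\<delta> + (?e + \<delta>)) (conjugate a g0) (conjugate b g1)"
        using a(2) near_hv[OF g(7)] near_sym[OF b(2)] by (intro near_trans)
      then have "near (3 * \<delta>) (conjugate a g0) (conjugate b g1)"
        by (rule near_mono) (use e(2) in simp)
      then have "near (3 * \<delta>) (conjugate (inv a) (conjugate b g1)) g0"
        using near_sym near_conjugate[of "inv a"] a(1) by (metis conjugate_inv_conjugate inv_in)
      moreover have g1G: "g1 \<in> G" using g(2) by blast
      ultimately have "conjugate (inv a) (conjugate b g1) \<in> nbhd G (W n) \<epsilon>"
        using a(1) b(1) g(1) \<delta>(2) by (intro near_imp_in_nbhd) auto
      moreover have "a \<in> nbhd G (W n) \<epsilon>" "b \<in> nbhd G (W n) \<epsilon>" "inv a \<in> nbhd G (W n) \<epsilon>" "inv b \<in> nbhd G (W n) \<epsilon>"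
        using subset_nbhd[OF WG \<epsilon>, of n] ab W(2) by blast+
      ultimately have "inv b \<circ> (a \<circ> (conjugate (inv a) (conjugate b g1) \<circ> (inv a \<circ> b)))
          \<in> set_power (nbhd G (W n) \<epsilon>) (Suc 0 + (Suc 0 + (Suc 0 + (Suc 0 + Suc 0))))"
        by (intro set_power_comp set_power_Suc_0)
      moreover have "inv b \<circ> (a \<circ> (conjugate (inv a) (conjugate b g1) \<circ> (inv a \<circ> b))) = g1"
        using a(1) b(1) by (simp add: conjugate_def fun_eq_iff)
      moreover have "Suc 0 + (Suc 0 + (Suc 0 + (Suc 0 + Suc 0))) = 5" by simp
      ultimately show False using g(2) by (metis DiffD2)
    qed
    then have "L (Suc n) ?\<sigma>0 \<inter> W n = {} \<or> L (Suc n) ?\<sigma>1 \<inter> W n = {}" by blast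
    then show ?thesis using R0 R1 by blast
  qed
  (* Steering away from W n at stage n yields a limit lying in no W n. *)
  obtain x0 where x0: "x0 \<in> C 0" using C unfolding generic_tower_def by blast
  have "\<exists>s. \<forall>n. valid n (s n) \<and> (R n (s n) (s (Suc n)) \<and> L (Suc n) (s (Suc n)) \<inter> W n = {})"
  proof (rule dependent_nat_choice)
    show "\<exists>\<sigma>. valid 0 \<sigma>" using x0 by (intro exI[of _ "(x0, id)"]) (simp add: valid_def)
    fix \<sigma> n assume "valid n \<sigma>"
    then show "\<exists>\<sigma>'. valid (Suc n) \<sigma>' \<and> (R n \<sigma> \<sigma>' \<and> L (Suc n) \<sigma>' \<inter> W n = {})"
      using split[of n \<sigma>] unfolding R_def by blast
  qed
  then obtain s where s: "\<And>n. valid n (s n)" "\<And>n. R n (s n) (s (Suc n))"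
    "\<And>n. L (Suc n) (s (Suc n)) \<inter> W n = {}" by blast
  have sM: "snd (s n) \<in> M" for n using s(1)[of n] M by (simp add: valid_def)
  have telescope: "d (snd (s n)) (snd (s (n + k))) \<le> 2 * (1/2) ^ n - 2 * (1/2) ^ (n + k)" for n k
  proof (induction k)
    case (Suc k)
    have "d (snd (s (n + k))) (snd (s (n + Suc k))) < (1/2) ^ (n + k)" using s(2)[of "n + k"] by (simp add: R_def)
    then show ?case
      using Suc triangle[OF sM[of n] sM[of "n + k"] sM[of "n + Suc k"]] by simp
  qed (use sM in simp)
  have dist_s: "d (snd (s n)) (snd (s m)) \<le> 2 * (1/2) ^ n" if "n \<le> m" for n m
  proof -
    have "(1/2::real) ^ m \<ge> 0" by simp
    moreover have "d (snd (s n)) (snd (s m)) \<le> 2 * (1/2) ^ n - 2 * (1/2) ^ m"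
      using telescope[of n "m - n"] that by simp
    ultimately show ?thesis by linarith
  qed
  have "MCauchy (\<lambda>n. snd (s n))"
    unfolding MCauchy_def
  proof (intro conjI allI impI)
    show "range (\<lambda>n. snd (s n)) \<subseteq> M" using sM by blast
    fix e :: real assume "e > 0"
    then obtain N where N: "(1/2) ^ N < e / 4" using real_arch_pow_inv[of "e/4" "1/2"] by auto
    have "d (snd (s n)) (snd (s m)) < e" if "N \<le> n" "N \<le> m" for n m
      using triangle''[OF sM[of n] sM[of N] sM[of m]] dist_s[OF that(1)] dist_s[OF that(2)] N by linarith
    then show "\<exists>N. \<forall>n m. N \<le> n \<longrightarrow> N \<le> m \<longrightarrow> d (snd (s n)) (snd (s m)) < e" by blast
  qed
  then obtain h where lim: "limitin (tau G) (\<lambda>n. snd (s n)) h sequentially"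
    using comp unfolding mcomplete_def top by blast
  then have "h \<in> G" using limitin_topspace[OF lim] by simp
  then obtain n where "h \<in> W n" using W(1) by blast
  \<comment> \<open>The tail of the path is itself an admissible continuation of its state at stage
    n + 1.\<close>
  moreover have "h \<in> L (Suc n) (s (Suc n))"
    unfolding L_def
  proof (intro CollectI exI[of _ "\<lambda>k. s (Suc n + k)"] conjI allI)
    show "limitin (tau G) (\<lambda>k. snd (s (Suc n + k))) h sequentially"
      using limitin_sequentially_offset[OF lim, of "Suc n"] by (simp add: add.commute)
  qed (use s(2)[of "Suc n + k" for k] in auto)
  ultimately show False using s(3) by blast
qed

theorem metrically_Bergman_21:
  assumes olig: "approx_oligomorphic G" and ample: "ample_generics G"
  shows "metrically_Bergman 21 G"
  unfolding metrically_Bergman_def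
proof (intro allI impI)
  fix W :: "nat \<Rightarrow> ('a \<Rightarrow> 'a) set" and \<epsilon> :: real
  assume W: "(\<forall>n. W n \<subseteq> W (Suc n)) \<and> (\<Union>n. W n) = G" and \<epsilon>: "\<epsilon> > 0"
  have mono: "W m \<subseteq> W n" if "m \<le> n" for m n using W that lift_Suc_mono_le[of W] by blast
  define W' where "W' n = {g \<in> W n. inv g \<in> W n}" for n
  have W'_mono: "W' m \<subseteq> W' n" if "m \<le> n" for m n using mono[OF that] by (auto simp: W'_def)
  have W'_G: "W' n \<subseteq> G" for n using W by (auto simp: W'_def)
  have W'_inv: "inv g \<in> W' n" if "g \<in> W' n" for g n
    using that W'_G[of n] by (auto simp: W'_def)
  have W'_ex: "\<exists>n. g \<in> W' n" if g: "g \<in> G" for g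
  proof -
    obtain m n where "g \<in> W m" "inv g \<in> W n" using W g inv_in[OF g] by blast
    then have "g \<in> W' (max m n)" using mono[of m "max m n"] mono[of n "max m n"] by (auto simp: W'_def)
    then show ?thesis by blast
  qed
  have "\<exists>n. \<not> meagre_in (tau G) (W' n)"
  proof (rule ccontr)
    assume "\<not> ?thesis"
    then have "meagre_in (tau G) (\<Union>n. W' n)" by (intro meagre_in_countable_Union) auto
    moreover have "G \<subseteq> (\<Union>n. W' n)" using W'_ex by blast
    ultimately show False using nonmeagre_tau meagre_in_subset by blast
  qed
  then obtain n0 where n0: "\<not> meagre_in (tau G) (W' n0)" by blast
  have "\<exists>n U. openin (tau G) U \<and> U \<noteq> {} \<and> meagre_in (tau G) (U - set_power (nbhd G (W' (n0 + n)) \<epsilon>) 5)"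
  proof (rule ex_comeagre_somewhere_power[OF ample \<epsilon>])
    show "(\<Union>n. W' (n0 + n)) = G"
    proof
      show "G \<subseteq> (\<Union>n. W' (n0 + n))"
      proof
        fix g assume "g \<in> G"
        then obtain n where "g \<in> W' n" using W'_ex by blast
        then show "g \<in> (\<Union>n. W' (n0 + n))" using W'_mono[of n "n0 + n"] by auto
      qed
    qed (use W'_G in blast)
    show "\<not> meagre_in (tau G) (W' (n0 + n))" for n
      using n0 W'_mono[of n0 "n0 + n"] meagre_in_subset by auto
  qed (rule W'_inv)
  then obtain n U where U: "openin (tau G) U" "U \<noteq> {}"
    "meagre_in (tau G) (U - set_power (nbhd G (W' (n0 + n)) \<epsilon>) 5)" by blast
  let ?N = "nbhd G (W' (n0 + n)) \<epsilon>"
  obtain V where V: "openin (tau G) V" "id \<in> V"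
    "\<And>v. v \<in> V \<Longrightarrow> \<exists>s\<in>set_power ?N 5. \<exists>t\<in>set_power ?N 5. v = s \<circ> inv t"
    using Pettis[OF U] by blast
  have V10: "V \<subseteq> set_power ?N 10"
  proof
    fix v assume "v \<in> V"
    then obtain s t where st: "s \<in> set_power ?N 5" "t \<in> set_power ?N 5" "v = s \<circ> inv t" using V(3) by blast
    have "inv t \<in> set_power ?N 5"
      using st(2) by (intro inv_in_set_power nbhd_subset inv_in_nbhd W'_G W'_inv)
    then have "v \<in> set_power ?N (5 + 5)" unfolding st(3) using st(1) by (rule set_power_comp)
    then show "v \<in> set_power ?N 10" by simp
  qed
  obtain Q \<delta> where Q: "finite Q" "\<delta> > 0" "basic_nbhd Q \<delta> \<subseteq> V"
    using basic_nbhd_subset_open[OF V(1,2)] .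
  obtain F where F: "finite F" "F \<subseteq> G"
    "\<And>g. g \<in> G \<Longrightarrow> \<exists>v\<in>basic_nbhd Q \<delta>. \<exists>f\<in>F. \<exists>w\<in>basic_nbhd Q \<delta>. g = v \<circ> (f \<circ> w)"
    using approx_oligomorphic_double_cosets[OF olig Q(1,2)] by metis
  obtain k where k: "\<And>f. f \<in> F \<Longrightarrow> f \<in> W (k f)" using F(2) W by (metis UN_iff subsetD)
  \<comment> \<open>Finiteness of \<open>F\<close> allows a single index for all its elements. It is
    also kept above \<open>n0 + n\<close>, so that the tenth power containing \<open>V\<close> is
    absorbed by the same neighbourhood.\<close>
  define p where "p = Max (insert (n0 + n) (k ` F))"
  have p: "n0 + n \<le> p" "\<And>f. f \<in> F \<Longrightarrow> k f \<le> p" using F(1) by (auto simp: p_def)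
  let ?P = "nbhd G (W p) \<epsilon>"
  have "W' (n0 + n) \<subseteq> W p" using mono[OF p(1)] by (auto simp: W'_def)
  then have "set_power ?N 10 \<subseteq> set_power ?P 10" by (intro set_power_mono nbhd_mono)
  then have B: "basic_nbhd Q \<delta> \<subseteq> set_power ?P 10" using V10 Q(3) by blast
  have "G \<subseteq> set_power ?P 21"
  proof
    fix g assume "g \<in> G"
    then obtain v f w where g: "v \<in> basic_nbhd Q \<delta>" "f \<in> F" "w \<in> basic_nbhd Q \<delta>" "g = v \<circ> (f \<circ> w)"
      using F(3) by blast
    have "W p \<subseteq> G" using W by blast
    then have "f \<in> ?P" using k[OF g(2)] mono[OF p(2)[OF g(2)]] subset_nbhd[OF _ \<epsilon>, of "W p"] by blast
    then have "g \<in> set_power ?P (10 + (Suc 0 + 10))"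
      unfolding g(4) using B g(1,3) by (intro set_power_comp set_power_Suc_0) auto
    then show "g \<in> set_power ?P 21" by simp
  qed
  moreover have "set_power ?P 21 \<subseteq> G" by (intro set_power_subset nbhd_subset)
  ultimately show "\<exists>n. set_power (nbhd G (W n) \<epsilon>) 21 = G" by blast
qed

end

theorem theorem4p13:
  fixes G :: "('a::polish_space \<Rightarrow> 'a) set"
  assumes "closed_subgroup_Iso G"
    and "approx_oligomorphic G"
    and "ample_generics G"
  shows "metrically_Bergman 21 G"
  using closed_isometry_group.metrically_Bergman_21[OF closed_isometry_group.intro] assms by blast

end
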